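(* Let $n\ge1$ be an integer and let $\Lambda$ be a set with $\Lambda_0(n)\subset\Lambda\subset\Lambda_1(n)$. Let $G$ be a closed subgroup of $\mathrm{B}(n)$, with inclusion map $\iota_G:G\to\mathrm{B}(n)$. Equip $G$ with its LR-coarse structure and $\mathbb{R}^\Lambda$ with the bounded coarse structure. Then the composition $\mu_\Lambda\circ\iota_G:G\to\mathbb{R}^\Lambda$ is coarse. In particular, for closed subgroups $L,H$ of $G$, if the pair $(\mu_\Lambda\circ\iota_G(L),\mu_\Lambda\circ\iota_G(H))$ is asymptotically disjoint in $\mathbb{R}^\Lambda$ (with the bounded coarse structure), then the natural $L$-action on $G/H$ is proper.
   Context: $[n]:=\{1,\dots,n\}$. $\mathrm{B}(n)$ is the topological group of invertible real upper triangular $n\times n$ matrices. For a real square matrix $X=(x_{ij})$, $\|X\|:=\max_{i,j}|x_{ij}|$. For $1\le i\le j\le n$, $\Phi_{ij}:\mathrm{B}(n)\to\mathrm{B}(j-i+1)$ sends $X=(x_{st})_{1\le s,t\le n}$ to its submatrix $(x_{st})_{i\le s,t\le j}$. For $1\le q\le m$, $\bigwedge^q:\mathrm{GL}(m,\mathbb{R})\to\mathrm{GL}(\binom{m}{q},\mathbb{R})$ is the $q$-th exterior power (compound matrix): rows and columns are indexed by $q$-element subsets $I,J$ of $[m]$ in lexicographic order, and the $(I,J)$-entry of $\bigwedge^qA$ is the minor $\det(A_{IJ})$. $\Lambda_0(n):=\{(i,j,q,\varepsilon)\in[n]^3\times\{\pm1\} : q=\varepsilon=1 \text{ and } (i=j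 \text{ or } (i,j)=(1,n))\}$; $\Lambda_1(n):=\{(i,j,q,\varepsilon)\in[n]^3\times\{\pm1\} : i\le j,\ 1\le q\le j-i+1\}$. For nonempty $\Lambda\subset\Lambda_1(n)$, $\mu_\Lambda:\mathrm{B}(n)\to\mathbb{R}^\Lambda$ is $\mu_\Lambda(X):=\bigl(\log\|\bigwedge^q\Phi_{ij}(X^\varepsilon)\|\bigr)_{(i,j,q,\varepsilon)\in\Lambda}$. A coarse structure on a set $S$ is a family $\mathcal{E}$ of subsets of $S\times S$ (entourages) containing the diagonal and closed under transposition, finite unions, composition and passing to subsets. A subset $B\subset S$ is bounded if $B\times B\in\mathcal{E}$. For $E\in\mathcal{E}$ and $A\subset S$, $E[A]:=\{y : (y,a)\in E \text{ for some } a\in A\}$. The bounded coarse structure of a metric space consists of all $E$ with $\sup_{(x,y)\in E}d(x,y)<\infty$; on $\mathbb{R}^\Lambda$ use any norm metric. The LR-coarse structure on a locally compact Hausdorff group $G$ consists of all $E\subset G\times G$ such that, for some compact $C\subset G$, every $(x,y)\in E$ satisfies $x\in CyC^{-1}$. A map $f:(S,\mathcal{E})\to(T,\mathcal{F})$ is controlled if $\{(f(x),f(y)) : (x,y)\in E\}\in\mathcal{F}$ for every $E\in\mathcal{E}$; coarsely proper if preimages of bounded sets are bounded; coarse if it is both. A pair $(A,D)$ of subsets of $(S,\mathcal{E})$ is asymptotically disjoint if $A\cap E[D]$ is bounded for every $E\in\mathcal{E}$. The natural $L$-action on $G/H$ is $(\ell,gH)\mapsto\ell gH$. A continuous action of a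 locally compact Hausdorff group $L$ on a locally compact Hausdorff space $S$ is proper if the map $L\times S\to S\times S$, $(g,x)\mapsto(x,gx)$, is such that preimages of compact sets are compact. *)

theory Defs
  imports
    "HOL-Analysis.Analysis"
    "HOL-Algebra.Left_Coset"
    "HOL-Algebra.Group_Action"
    "Jordan_Normal_Form.Determinant"
    "Jordan_Normal_Form.DL_Submatrix"
begin

section \<open>Coarse structures\<close>

definition coarse_structure :: "'a set \<Rightarrow> ('a \<times> 'a) set set \<Rightarrow> bool" where
  "coarse_structure S \<E> \<longleftrightarrow>
     \<E> \<subseteq> Pow (S \<times> S) \<and>
     Id_on S \<in> \<E> \<and>
     (\<forall>E\<in>\<E>. E\<inverse> \<in> \<E>) \<and>
     (\<forall>E\<in>\<E>. \<forall>F\<in>\<E>. E \<union> F \<in> \<E>) \<and>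
     (\<forall>E\<in>\<E>. \<forall>F\<in>\<E>. E O F \<in> \<E>) \<and>
     (\<forall>E\<in>\<E>. \<forall>F. F \<subseteq> E \<longrightarrow> F \<in> \<E>)"

definition coarsely_bounded :: "('a \<times> 'a) set set \<Rightarrow> 'a set \<Rightarrow> bool" where
  "coarsely_bounded \<E> B \<longleftrightarrow> B \<times> B \<in> \<E>"

definition thickening :: "('a \<times> 'a) set \<Rightarrow> 'a set \<Rightarrow> 'a set" where
  "thickening E A = {y. \<exists>a\<in>A. (y, a) \<in> E}"

definition controlled_map ::
    "('a \<times> 'a) set set \<Rightarrow> ('b \<times> 'b) set set \<Rightarrow> ('a \<Rightarrow> 'b) \<Rightarrow> bool" where
  "controlled_map \<E> \<F> f \<longleftrightarrow> (\<forall>E\<in>\<E>. {(f x, f y) | x y. (x, y) \<in> E} \<in> \<F>)"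

definition coarsely_proper_map ::
    "'a set \<Rightarrow> ('a \<times> 'a) set set \<Rightarrow> 'b set \<Rightarrow> ('b \<times> 'b) set set \<Rightarrow> ('a \<Rightarrow> 'b) \<Rightarrow> bool" where
  "coarsely_proper_map S \<E> T \<F> f \<longleftrightarrow>
     (\<forall>B\<subseteq>T. coarsely_bounded \<F> B \<longrightarrow> coarsely_bounded \<E> {x\<in>S. f x \<in> B})"

definition coarse_map ::
    "'a set \<Rightarrow> ('a \<times> 'a) set set \<Rightarrow> 'b set \<Rightarrow> ('b \<times> 'b) set set \<Rightarrow> ('a \<Rightarrow> 'b) \<Rightarrow> bool" where
  "coarse_map S \<E> T \<F> f \<longleftrightarrow>
     f \<in> S \<rightarrow> T \<and> controlled_map \<E> \<F> f \<and> coarsely_proper_map S \<E> T \<F> f"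

definition asymptotically_disjoint ::
    "'a set \<Rightarrow> ('a \<times> 'a) set set \<Rightarrow> 'a set \<Rightarrow> 'a set \<Rightarrow> bool" where
  "asymptotically_disjoint S \<E> A D \<longleftrightarrow>
     A \<subseteq> S \<and> D \<subseteq> S \<and> (\<forall>E\<in>\<E>. coarsely_bounded \<E> (A \<inter> thickening E D))"

definition bounded_coarse :: "'a set \<Rightarrow> ('a \<Rightarrow> 'a \<Rightarrow> real) \<Rightarrow> ('a \<times> 'a) set set" where
  "bounded_coarse S d = {E. E \<subseteq> S \<times> S \<and> (\<exists>M. \<forall>(x, y)\<in>E. d x y \<le> M)}"

lemma (in Metric_space) coarse_structure_bounded_coarse:
  "coarse_structure M (bounded_coarse M d)"
  unfolding coarse_structure_def
proof (intro conjI ballI allI impI)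
  show "bounded_coarse M d \<subseteq> Pow (M \<times> M)"
    by (auto simp: bounded_coarse_def)
  show "Id_on M \<in> bounded_coarse M d"
    by (auto simp: bounded_coarse_def intro!: exI[of _ 0])
  fix E assume E: "E \<in> bounded_coarse M d"
  then obtain m where m: "E \<subseteq> M \<times> M" "\<And>x y. (x, y) \<in> E \<Longrightarrow> d x y \<le> m"
    unfolding bounded_coarse_def by blast
  have "\<forall>(x, y)\<in>E\<inverse>. d x y \<le> m"
  proof (clarsimp)
    fix x y assume "(y, x) \<in> E"
    then show "d x y \<le> m" using m(2)[of y x] commute[of x y] by simp
  qed
  then show "E\<inverse> \<in> bounded_coarse M d"
    using m(1) unfolding bounded_coarse_def by blast
  show "F \<in> bounded_coarse M d" if "F \<subseteq> E" for F
    using E that unfolding bounded_coarse_def by blast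
  fix F assume F: "F \<in> bounded_coarse M d"
  then obtain k where k: "F \<subseteq> M \<times> M" "\<And>x y. (x, y) \<in> F \<Longrightarrow> d x y \<le> k"
    unfolding bounded_coarse_def by blast
  have "\<forall>(x, y)\<in>E \<union> F. d x y \<le> max m k"
    using m(2) k(2) by (auto simp: le_max_iff_disj)
  then show "E \<union> F \<in> bounded_coarse M d"
    using m(1) k(1) unfolding bounded_coarse_def by blast
  have "d x z \<le> m + k" if "(x, y) \<in> E" "(y, z) \<in> F" for x y z
    using triangle[of x y z] m(1) k(1) m(2)[OF that(1)] k(2)[OF that(2)] that
    by (smt (verit) mem_Sigma_iff subsetD)
  then have "\<forall>(x, z)\<in>E O F. d x z \<le> m + k" by auto
  then show "E O F \<in> bounded_coarse M d"
    using m(1) k(1) unfolding bounded_coarse_def by blast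
qed

section \<open>Topological groups and proper actions\<close>

locale topological_group = group G for G :: "('a, 'm) monoid_scheme" (structure) +
  fixes T :: "'a topology"
  assumes topspace_eq: "topspace T = carrier G"
    and continuous_mult: "continuous_map (prod_topology T T) T (\<lambda>(x, y). x \<otimes> y)"
    and continuous_inv: "continuous_map T T (\<lambda>x. inv x)"

locale lch_group = topological_group +
  assumes Hausdorff: "Hausdorff_space T"
    and locally_compact: "locally_compact_space T"

definition closed_subgroup ::
    "'a set \<Rightarrow> ('a, 'm) monoid_scheme \<Rightarrow> 'a topology \<Rightarrow> bool" where
  "closed_subgroup K G T \<longleftrightarrow> subgroup K G \<and> closedin T K"

definition LR_coarse :: "('a, 'm) monoid_scheme \<Rightarrow> 'a topology \<Rightarrow> ('a \<times> 'a) set set" where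
  "LR_coarse G T = {E. E \<subseteq> carrier G \<times> carrier G \<and>
     (\<exists>C. compactin T C \<and> (\<forall>(x, y)\<in>E. x \<in> (C #>\<^bsub>G\<^esub> y) <#>\<^bsub>G\<^esub> (set_inv\<^bsub>G\<^esub> C)))}"

lemma LR_coarse_iff:
  "E \<in> LR_coarse G T \<longleftrightarrow> E \<subseteq> carrier G \<times> carrier G \<and>
     (\<exists>C. compactin T C \<and>
       (\<forall>(x, y)\<in>E. \<exists>c\<in>C. \<exists>d\<in>C. x = c \<otimes>\<^bsub>G\<^esub> y \<otimes>\<^bsub>G\<^esub> inv\<^bsub>G\<^esub> d))"
  unfolding LR_coarse_def r_coset_def set_mult_def SET_INV_def by simp

lemma (in topological_group) coarse_structure_LR_coarse:
  "coarse_structure (carrier G) (LR_coarse G T)"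
  unfolding coarse_structure_def
proof (intro conjI ballI allI impI)
  show "LR_coarse G T \<subseteq> Pow (carrier G \<times> carrier G)"
    by (auto simp: LR_coarse_def)
  have "compactin T {\<one>}" using topspace_eq by simp
  then show "Id_on (carrier G) \<in> LR_coarse G T"
    unfolding LR_coarse_iff by (intro conjI exI[of _ "{\<one>}"]) auto
  fix E assume E: "E \<in> LR_coarse G T"
  then obtain C where E0: "E \<subseteq> carrier G \<times> carrier G" and C: "compactin T C"
    and EC: "\<And>x y. (x, y) \<in> E \<Longrightarrow> \<exists>c\<in>C. \<exists>d\<in>C. x = c \<otimes> y \<otimes> inv d"
    unfolding LR_coarse_iff by blast
  have CG: "C \<subseteq> carrier G" using C topspace_eq compactin_subset_topspace by blast
  show "E\<inverse> \<in> LR_coarse G T"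
    unfolding LR_coarse_iff
  proof (intro conjI exI)
    show "compactin T ((\<lambda>x. inv x) ` C)"
      using C continuous_inv image_compactin by blast
    show "\<forall>(x, y)\<in>E\<inverse>. \<exists>c\<in>(\<lambda>x. inv x) ` C. \<exists>d\<in>(\<lambda>x. inv x) ` C. x = c \<otimes> y \<otimes> inv d"
    proof (clarsimp)
      fix x y assume xy: "(x, y) \<in> E"
      then obtain c d where cd: "c \<in> C" "d \<in> C" "x = c \<otimes> y \<otimes> inv d" using EC by blast
      have "c \<in> carrier G" "d \<in> carrier G" "y \<in> carrier G" using cd CG xy E0 by auto
      then have "y = inv c \<otimes> x \<otimes> inv (inv d)"
        unfolding cd(3) by (simp add: m_assoc m_assoc[symmetric, of "inv c" c])
      then show "\<exists>c\<in>C. \<exists>d\<in>C. y = inv c \<otimes> x \<otimes> inv (inv d)"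
        using cd by blast
    qed
  qed (use E0 in auto)
  show "F \<in> LR_coarse G T" if "F \<subseteq> E" for F
    using E that unfolding LR_coarse_iff by blast
  fix F assume F: "F \<in> LR_coarse G T"
  then obtain D where F0: "F \<subseteq> carrier G \<times> carrier G" and D: "compactin T D"
    and FD: "\<And>x y. (x, y) \<in> F \<Longrightarrow> \<exists>c\<in>D. \<exists>d\<in>D. x = c \<otimes> y \<otimes> inv d"
    unfolding LR_coarse_iff by blast
  have DG: "D \<subseteq> carrier G" using D topspace_eq compactin_subset_topspace by blast
  have "compactin T (C \<union> D)" using C D by (rule compactin_Un)
  moreover have "\<forall>(x, y)\<in>E \<union> F. \<exists>c\<in>C \<union> D. \<exists>d\<in>C \<union> D. x = c \<otimes> y \<otimes> inv d"
    using EC FD by blast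
  ultimately show "E \<union> F \<in> LR_coarse G T"
    unfolding LR_coarse_iff using E0 F0 by blast
  have "compactin (prod_topology T T) (C \<times> D)" using C D by (simp add: compactin_Times)
  then have "compactin T ((\<lambda>(x, y). x \<otimes> y) ` (C \<times> D))"
    using continuous_mult image_compactin by blast
  moreover have "\<exists>c\<in>(\<lambda>(x, y). x \<otimes> y) ` (C \<times> D). \<exists>d\<in>(\<lambda>(x, y). x \<otimes> y) ` (C \<times> D).
      x = c \<otimes> z \<otimes> inv d" if xy: "(x, y) \<in> E" and yz: "(y, z) \<in> F" for x y z
  proof -
    obtain c d where cd: "c \<in> C" "d \<in> C" "x = c \<otimes> y \<otimes> inv d" using EC xy by blast
    obtain a b where ab: "a \<in> D" "b \<in> D" "y = a \<otimes> z \<otimes> inv b" using FD yz by blast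
    have "c \<in> carrier G" "d \<in> carrier G" "a \<in> carrier G" "b \<in> carrier G" "z \<in> carrier G"
      using cd ab CG DG yz F0 by auto
    then have "x = (c \<otimes> a) \<otimes> z \<otimes> inv (d \<otimes> b)"
      unfolding cd(3) ab(3) by (simp add: m_assoc inv_mult_group)
    moreover have "c \<otimes> a \<in> (\<lambda>(x, y). x \<otimes> y) ` (C \<times> D)" "d \<otimes> b \<in> (\<lambda>(x, y). x \<otimes> y) ` (C \<times> D)"
      using cd ab by auto
    ultimately show ?thesis by blast
  qed
  ultimately show "E O F \<in> LR_coarse G T"
    unfolding LR_coarse_iff using E0 F0 by blast
qed

definition coset_topology ::
    "('a, 'm) monoid_scheme \<Rightarrow> 'a topology \<Rightarrow> 'a set \<Rightarrow> 'a set topology" where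
  "coset_topology G T H = topology (\<lambda>U. U \<subseteq> lcosets\<^bsub>G\<^esub> H \<and>
     openin T {g \<in> topspace T. g <#\<^bsub>G\<^esub> H \<in> U})"

lemma openin_coset_topology:
  "openin (coset_topology G T H) U \<longleftrightarrow>
     U \<subseteq> lcosets\<^bsub>G\<^esub> H \<and> openin T {g \<in> topspace T. g <#\<^bsub>G\<^esub> H \<in> U}"
proof -
  let ?P = "\<lambda>U. {g \<in> topspace T. g <#\<^bsub>G\<^esub> H \<in> U}"
  have "istopology (\<lambda>U. U \<subseteq> lcosets\<^bsub>G\<^esub> H \<and> openin T (?P U))"
    unfolding istopology_def
  proof (intro conjI allI impI)
    fix U V
    assume *: "U \<subseteq> lcosets\<^bsub>G\<^esub> H \<and> openin T (?P U)" "V \<subseteq> lcosets\<^bsub>G\<^esub> H \<and> openin T (?P V)"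
    have "?P (U \<inter> V) = ?P U \<inter> ?P V" by auto
    then show "U \<inter> V \<subseteq> lcosets\<^bsub>G\<^esub> H" "openin T (?P (U \<inter> V))" using * by auto
  next
    fix \<K> assume *: "\<forall>U\<in>\<K>. U \<subseteq> lcosets\<^bsub>G\<^esub> H \<and> openin T (?P U)"
    have "?P (\<Union>\<K>) = \<Union>(?P ` \<K>)" by auto
    then show "\<Union>\<K> \<subseteq> lcosets\<^bsub>G\<^esub> H" "openin T (?P (\<Union>\<K>))" using * by auto
  qed
  then show ?thesis unfolding coset_topology_def by (simp add: topology_inverse')
qed

lemma (in topological_group) quotient_map_coset_topology:
  "quotient_map T (coset_topology G T H) (\<lambda>g. g <# H)"
proof -
  have "openin (coset_topology G T H) (lcosets H)"
    unfolding openin_coset_topology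
  proof
    have "{g \<in> topspace T. g <# H \<in> lcosets H} = topspace T"
      by (auto simp: LCOSETS_def topspace_eq)
    then show "openin T {g \<in> topspace T. g <# H \<in> lcosets H}" by simp
  qed simp
  moreover have "topspace (coset_topology G T H) \<subseteq> lcosets H"
    using openin_coset_topology[of G T H "topspace (coset_topology G T H)"] by simp
  ultimately have top: "topspace (coset_topology G T H) = lcosets H"
    using openin_subset by blast
  show ?thesis
    unfolding quotient_map_def top openin_coset_topology
    by (auto simp: topspace_eq LCOSETS_def)
qed

definition coset_action ::
    "('a, 'm) monoid_scheme \<Rightarrow> 'a set \<Rightarrow> 'a \<Rightarrow> 'a set \<Rightarrow> 'a set" where
  "coset_action G H = (\<lambda>l. \<lambda>C \<in> lcosets\<^bsub>G\<^esub> H. l <#\<^bsub>G\<^esub> C)"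

definition continuous_action ::
    "('a, 'm) monoid_scheme \<Rightarrow> 'a topology \<Rightarrow> 'b topology \<Rightarrow> ('a \<Rightarrow> 'b \<Rightarrow> 'b) \<Rightarrow> bool" where
  "continuous_action L T S \<phi> \<longleftrightarrow>
     group_action L (topspace S) \<phi> \<and>
     continuous_map (prod_topology T S) S (\<lambda>(g, x). \<phi> g x)"

definition proper_action ::
    "('a, 'm) monoid_scheme \<Rightarrow> 'a topology \<Rightarrow> 'b topology \<Rightarrow> ('a \<Rightarrow> 'b \<Rightarrow> 'b) \<Rightarrow> bool" where
  "proper_action L T S \<phi> \<longleftrightarrow>
     lch_group L T \<and> Hausdorff_space S \<and> locally_compact_space S \<and>
     continuous_action L T S \<phi> \<and>
     (\<forall>K. compactin (prod_topology S S) K \<longrightarrow>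
        compactin (prod_topology T S)
          {(g, x). g \<in> topspace T \<and> x \<in> topspace S \<and> (x, \<phi> g x) \<in> K})"

section \<open>Upper triangular matrices\<close>

definition UT :: "nat \<Rightarrow> real mat monoid" where
  "UT n = \<lparr>carrier = {X \<in> carrier_mat n n. upper_triangular X \<and> invertible_mat X},
           mult = (*), one = 1\<^sub>m n\<rparr>"

text \<open>The topology of \<open>UT n\<close> as a subset of \<open>\<real>\<^bsup>n\<times>n\<^esup>\<close>: the coarsest one that makes all
  matrix entries continuous.\<close>

definition UT_top :: "nat \<Rightarrow> real mat topology" where
  "UT_top n = pullback_topology (carrier (UT n)) (\<lambda>X. \<lambda>p \<in> {..<n} \<times> {..<n}. X $$ p)
     (product_topology (\<lambda>_. euclideanreal) ({..<n} \<times> {..<n}))"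

definition max_norm :: "real mat \<Rightarrow> real" where
  "max_norm X = Max (abs ` elements_mat X)"

text \<open>Row and column numbers of matrices start at 0 in the library, while \<open>i\<close> and \<open>j\<close>
  start at 1, as in \<open>[n] = {1..n}\<close>.\<close>

definition block :: "nat \<Rightarrow> nat \<Rightarrow> real mat \<Rightarrow> real mat" where
  "block i j X = submatrix X {i - 1..<j} {i - 1..<j}"

text \<open>\<^const>\<open>subseqs\<close> puts the sublists containing the head before those that do not, so
  that those of a fixed length appear in lexicographic order.\<close>

definition lex_lists :: "nat \<Rightarrow> nat \<Rightarrow> nat list list" where
  "lex_lists m q = filter (\<lambda>I. length I = q) (subseqs [0..<m])"

lemma sorted_wrt_subseqs:
  "xs \<in> set (subseqs ys) \<Longrightarrow> sorted_wrt P ys \<Longrightarrow> sorted_wrt P xs"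
proof (induction ys arbitrary: xs)
  case (Cons y ys)
  have "set zs \<subseteq> set ys" if "zs \<in> set (subseqs ys)" for zs
    using that subseqs_powset[of ys] by blast
  with Cons show ?case by (fastforce simp: Let_def)
qed simp

lemma lex_lists_sorted: "sorted_wrt (\<lambda>I J. (I, J) \<in> lexord {(a, b). a < b}) (lex_lists m q)"
proof -
  have "sorted_wrt (\<lambda>I J. (I, J) \<in> lexord {(a, b). a < b})
          (filter (\<lambda>I. length I = q) (subseqs xs))" if "sorted_wrt (<) xs" for xs :: "nat list"
    using that
  proof (induction xs arbitrary: q)
    case (Cons x xs)
    define L where "L r = filter (\<lambda>I. length I = r) (subseqs xs)" for r
    have *: "filter (\<lambda>I. length I = q) (subseqs (x # xs)) =
        (case q of 0 \<Rightarrow> [] | Suc r \<Rightarrow> map (Cons x) (L r)) @ L q"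
      by (auto simp: L_def Let_def filter_map o_def split: nat.split)
    have IH: "sorted_wrt (\<lambda>I J. (I, J) \<in> lexord {(a, b). a < b}) (L r)" for r
      using Cons by (simp add: L_def)
    have "(x # I, J) \<in> lexord {(a, b). a < b}" if q: "q = Suc r" and J: "J \<in> set (L q)" for I J r
    proof (cases J)
      case Nil
      then show ?thesis using J q by (auto simp: L_def)
    next
      case (Cons j J')
      then have "j \<in> set xs" using J subseqs_powset[of xs]
        by (metis L_def PowD filter_is_subset image_eqI list.set_intros(1) subsetD)
      then show ?thesis using Cons \<open>sorted_wrt (<) (x # xs)\<close> by auto
    qed
    then show ?case
      unfolding * using IH by (auto simp: sorted_wrt_append sorted_wrt_map split: nat.split)
  qed simp
  then show ?thesis by (simp add: lex_lists_def)
qed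

lemma set_lex_lists:
  "set (lex_lists m q) = {I. sorted_wrt (<) I \<and> length I = q \<and> set I \<subseteq> {..<m}}"
proof (intro equalityI subsetI)
  fix I assume "I \<in> set (lex_lists m q)"
  then have *: "I \<in> set (subseqs [0..<m])" "length I = q" by (auto simp: lex_lists_def)
  have "set I \<subseteq> {..<m}" using *(1) subseqs_powset[of "[0..<m]"] by (auto simp: lessThan_atLeast0)
  then show "I \<in> {I. sorted_wrt (<) I \<and> length I = q \<and> set I \<subseteq> {..<m}}"
    using * sorted_wrt_subseqs[OF *(1)] by auto
next
  fix I assume "I \<in> {I. sorted_wrt (<) I \<and> length I = q \<and> set I \<subseteq> {..<m}}"
  then have I: "sorted_wrt (<) I" "length I = q" "set I \<subseteq> {..<m}" by auto
  then have "set I \<in> set ` set (subseqs [0..<m])"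
    unfolding subseqs_powset by auto
  then obtain J where J: "J \<in> set (subseqs [0..<m])" "set I = set J" by auto
  have "sorted_wrt (<) J" using sorted_wrt_subseqs[OF J(1)] by simp
  with I(1) J(2) have "I = J" by (simp add: strict_sorted_equal)
  with J I show "I \<in> set (lex_lists m q)" by (auto simp: lex_lists_def)
qed

lemma length_lex_lists: "length (lex_lists m q) = m choose q"
proof -
  have d: "distinct (map set (lex_lists m q))"
    unfolding lex_lists_def by (intro distinct_map_filter distinct_set_subseqs) simp
  have "set ` set (lex_lists m q) = {I. I \<subseteq> {..<m} \<and> card I = q}"
  proof (intro equalityI subsetI)
    fix I assume I: "I \<in> {I. I \<subseteq> {..<m} \<and> card I = q}"
    then have "finite I" using finite_subset by blast
    with I show "I \<in> set ` set (lex_lists m q)"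
      by (intro image_eqI[of _ _ "sorted_list_of_set I"]) (auto simp: set_lex_lists)
  qed (auto simp: set_lex_lists strict_sorted_iff distinct_card)
  then show ?thesis
    using distinct_card[OF d] n_subsets[of "{..<m}" q] by simp
qed

definition exterior_power :: "nat \<Rightarrow> real mat \<Rightarrow> real mat" where
  "exterior_power q A = (let m = dim_row A; N = m choose q in
     mat N N (\<lambda>(a, b). Determinant.det
       (submatrix A (set (lex_lists m q ! a)) (set (lex_lists m q ! b)))))"

section \<open>The map \<open>\<mu>\<close>\<close>

type_synonym index = "nat \<times> nat \<times> nat \<times> int"

definition Index0 :: "nat \<Rightarrow> index set" where
  "Index0 n = {(i, j, q, e). i \<in> {1..n} \<and> j \<in> {1..n} \<and> q \<in> {1..n} \<and> e \<in> {1, -1} \<and>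
     q = 1 \<and> e = 1 \<and> (i = j \<or> (i, j) = (1, n))}"

definition Index1 :: "nat \<Rightarrow> index set" where
  "Index1 n = {(i, j, q, e). i \<in> {1..n} \<and> j \<in> {1..n} \<and> q \<in> {1..n} \<and> e \<in> {1, -1} \<and>
     i \<le> j \<and> 1 \<le> q \<and> q \<le> j - i + 1}"

text \<open>\<open>\<real>\<^bsup>\<Lambda>\<^esup>\<close> consists of the functions on \<open>\<Lambda>\<close>, with the metric of the maximum norm; all norms
  on this finite-dimensional space have the same bounded coarse structure.\<close>

abbreviation RR :: "index set \<Rightarrow> (index \<Rightarrow> real) set" where
  "RR \<Lambda> \<equiv> \<Lambda> \<rightarrow>\<^sub>E UNIV"

definition max_dist :: "index set \<Rightarrow> (index \<Rightarrow> real) \<Rightarrow> (index \<Rightarrow> real) \<Rightarrow> real" where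
  "max_dist \<Lambda> x y = Max ((\<lambda>l. \<bar>x l - y l\<bar>) ` \<Lambda>)"

lemma Metric_space_max_dist:
  assumes "finite \<Lambda>" "\<Lambda> \<noteq> {}"
  shows "Metric_space (RR \<Lambda>) (max_dist \<Lambda>)"
proof
  have ge: "\<bar>x l - y l\<bar> \<le> max_dist \<Lambda> x y" if "l \<in> \<Lambda>" for x y l
    using assms that by (simp add: max_dist_def)
  obtain l0 where l0: "l0 \<in> \<Lambda>" using assms by blast
  show nn: "0 \<le> max_dist \<Lambda> x y" for x y
    using ge[OF l0, of x y] by linarith
  show "max_dist \<Lambda> x y = max_dist \<Lambda> y x" for x y
    by (simp add: max_dist_def abs_minus_commute)
  show "max_dist \<Lambda> x y = 0 \<longleftrightarrow> x = y" if "x \<in> RR \<Lambda>" "y \<in> RR \<Lambda>" for x y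
  proof
    assume "max_dist \<Lambda> x y = 0"
    then have "x l = y l" if "l \<in> \<Lambda>" for l using ge[OF that, of x y] by simp
    then show "x = y" using that by (intro PiE_ext) auto
  next
    assume "x = y"
    then show "max_dist \<Lambda> x y = 0" using assms by (simp add: max_dist_def image_constant_conv)
  qed
  show "max_dist \<Lambda> x z \<le> max_dist \<Lambda> x y + max_dist \<Lambda> y z" for x y z
  proof -
    have "\<bar>x l - z l\<bar> \<le> max_dist \<Lambda> x y + max_dist \<Lambda> y z" if "l \<in> \<Lambda>" for l
      using ge[OF that, of x y] ge[OF that, of y z] by linarith
    then show ?thesis using assms unfolding max_dist_def[of \<Lambda> x z] by simp
  qed
qed

definition mu :: "nat \<Rightarrow> index set \<Rightarrow> real mat \<Rightarrow> index \<Rightarrow> real" where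
  "mu n \<Lambda> X = (\<lambda>(i, j, q, e) \<in> \<Lambda>.
     ln (max_norm (exterior_power q (block i j (X [^]\<^bsub>UT n\<^esub> e)))))"

end

theory Submission
  imports Defs
begin

text \<open>Expanding a minor of \<open>AB\<close> multilinearly in the rows of \<open>A\<close> bounds the norm of
  \<open>\<And>\<^sup>q(AB)\<close> by that of \<open>\<And>\<^sup>qB\<close> times a constant depending only on the size of the entries of
  \<open>A\<close>, and symmetrically for \<open>B\<close>. On triangular matrices \<open>\<Phi>\<^sub>i\<^sub>j\<close> is multiplicative, so for \<open>c\<close>, \<open>d\<close>
  in a compact set, \<open>\<mu>(cyd\<inverse>)\<close> and \<open>\<mu>(y)\<close> differ by a bounded amount; the reverse estimate comes
  from \<open>y = c\<inverse>(cyd\<inverse>)d\<close>. Conversely, the coordinates of \<open>\<mu>\<close> indexed by \<open>\<Lambda>\<^sub>0\<close> control all entries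
  and the inverses of the diagonal entries, hence confine \<open>X\<close> to a compact set.

  If \<open>lx = y\<close> in \<open>G/H\<close> with \<open>x\<close>, \<open>y\<close> in the image of a compact \<open>C \<subseteq> G\<close>, then \<open>l \<in> CHC\<inverse>\<close>. The
  \<open>\<mu>\<close>-image of \<open>L \<inter> CHC\<inverse>\<close> is bounded by asymptotic disjointness, so \<open>L \<inter> CHC\<inverse>\<close> is relatively
  compact.\<close>

(* HOL-Library.Multiset also uses this symbol, which makes left cosets ambiguous. *)
no_notation subset_mset (infix "<#" 50)

section \<open>Coset spaces of topological groups\<close>

text \<open>Open sets contained in compact sets have open images, and these cover \<open>K\<close>.
  Finitely many suffice, and the union of the corresponding compact sets is \<open>C\<close>.
  Applied to the projection onto a coset space, this replaces compact sets of cosets by compact sets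
  of group elements.\<close>

lemma compactin_lift_open_map:
  assumes loc: "locally_compact_space X" and f: "open_map X Y f" "f ` topspace X = topspace Y"
    and K: "compactin Y K"
  obtains C where "compactin X C" "K \<subseteq> f ` C"
proof -
  define \<U> where "\<U> = {f ` U | U. openin X U \<and> (\<exists>C. compactin X C \<and> U \<subseteq> C)}"
  have cover: "K \<subseteq> \<Union>\<U>"
  proof
    fix y assume "y \<in> K"
    then obtain x where x: "x \<in> topspace X" "y = f x"
      using K f(2) compactin_subset_topspace by blast
    then obtain U C where "openin X U" "compactin X C" "x \<in> U" "U \<subseteq> C"
      using loc unfolding locally_compact_space_def by blast
    then show "y \<in> \<Union>\<U>" unfolding \<U>_def using x by blast
  qed
  have op: "openin Y V" if "V \<in> \<U>" for V
    using that f(1) unfolding \<U>_def open_map_def by blast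
  have "\<exists>\<F>. finite \<F> \<and> \<F> \<subseteq> \<U> \<and> K \<subseteq> \<Union>\<F>"
    using op by (rule compactinD[OF K _ cover])
  then obtain \<F> where F: "finite \<F>" "\<F> \<subseteq> \<U>" "K \<subseteq> \<Union>\<F>"
    by auto
  have "\<forall>V\<in>\<F>. \<exists>C. compactin X C \<and> V \<subseteq> f ` C"
  proof
    fix V assume "V \<in> \<F>"
    then have "V \<in> \<U>" using F(2) by auto
    then obtain U C where "V = f ` U" "compactin X C" "U \<subseteq> C" unfolding \<U>_def by auto
    then have "compactin X C \<and> V \<subseteq> f ` C" by auto
    then show "\<exists>C. compactin X C \<and> V \<subseteq> f ` C" ..
  qed
  then obtain c where "\<forall>V\<in>\<F>. compactin X (c V) \<and> V \<subseteq> f ` c V"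
    unfolding bchoice_iff by blast
  then have c: "\<And>V. V \<in> \<F> \<Longrightarrow> compactin X (c V)" "\<And>V. V \<in> \<F> \<Longrightarrow> V \<subseteq> f ` c V"
    by auto
  have "compactin X (\<Union>(c ` \<F>))"
    using F(1) c(1) by (intro compactin_Union) auto
  moreover have "K \<subseteq> f ` \<Union>(c ` \<F>)"
    using F(3) c(2) by blast
  ultimately show ?thesis by (rule that)
qed

section \<open>The projection onto a coset space and translation of cosets\<close>

context topological_group
begin


lemma continuous_map_mult:
  assumes "continuous_map X T f" "continuous_map X T g"
  shows "continuous_map X T (\<lambda>x. f x \<otimes> g x)"
proof -
  have "continuous_map X (prod_topology T T) (\<lambda>x. (f x, g x))"
    using assms by (simp add: continuous_map_paired)
  from continuous_map_compose[OF this continuous_mult] show ?thesis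
    by (simp add: o_def)
qed

lemma continuous_map_m_inv:
  assumes "continuous_map X T f"
  shows "continuous_map X T (\<lambda>x. inv (f x))"
  using continuous_map_compose[OF assms continuous_inv] by (simp add: o_def)

lemma topspace_coset_topology: "topspace (coset_topology G T H) = lcosets H"
  using quotient_imp_surjective_map[OF quotient_map_coset_topology[of H]]
  by (auto simp: topspace_eq LCOSETS_def)

text \<open>Expresses equality of cosets through the continuous expression
  \<open>inv x \<otimes> y\<close>, the form in which separation and properness are proved
  below.\<close>

lemma l_coset_eq_iff:
  assumes "subgroup H G" "x \<in> carrier G" "y \<in> carrier G"
  shows "x <# H = y <# H \<longleftrightarrow> inv x \<otimes> y \<in> H"
proof
  assume "x <# H = y <# H"
  then have "y \<in> x <# H" using lcos_self assms by simp
  then obtain h where h: "h \<in> H" "y = x \<otimes> h" by (auto simp: l_coset_def)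
  have "h \<in> carrier G" using subgroup.mem_carrier[OF assms(1) h(1)] .
  then show "inv x \<otimes> y \<in> H" using h assms by (simp add: m_assoc[symmetric])
next
  assume "inv x \<otimes> y \<in> H"
  moreover have "y = x \<otimes> (inv x \<otimes> y)" using assms by (simp add: m_assoc[symmetric])
  ultimately have "y \<in> x <# H" unfolding l_coset_def by blast
  then show "x <# H = y <# H" using l_repr_independence assms by blast
qed

text \<open>The saturation of an open set \<open>U\<close> is the union of its right translates by
  elements of \<open>H\<close>, and each translate is open as a preimage of \<open>U\<close> under a
  right translation.\<close>

lemma open_map_coset:
  assumes H: "subgroup H G"
  shows "open_map T (coset_topology G T H) (\<lambda>g. g <# H)"
  unfolding open_map_def openin_coset_topology
proof (intro allI impI conjI)
  fix U assume U: "openin T U"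
  then have UG: "U \<subseteq> carrier G" using openin_subset topspace_eq by blast
  have HG: "H \<subseteq> carrier G" using H by (rule subgroup.subset)
  show "(\<lambda>g. g <# H) ` U \<subseteq> lcosets H" using UG by (auto simp: LCOSETS_def)
  have "{g \<in> topspace T. g <# H \<in> (\<lambda>g. g <# H) ` U} = (\<Union>h\<in>H. {g \<in> topspace T. g \<otimes> h \<in> U})"
  proof safe
    fix g u assume g: "g \<in> topspace T" and u: "u \<in> U" "g <# H = u <# H"
    then have "inv g \<otimes> u \<in> H" using l_coset_eq_iff[OF H] UG topspace_eq by auto
    moreover have "g \<otimes> (inv g \<otimes> u) = u"
      using g u UG topspace_eq by (auto simp: m_assoc[symmetric])
    ultimately show "g \<in> (\<Union>h\<in>H. {g \<in> topspace T. g \<otimes> h \<in> U})" using g u by force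
  next
    fix g h assume *: "g \<in> topspace T" "h \<in> H" "g \<otimes> h \<in> U"
    then have "g <# H = (g \<otimes> h) <# H"
      using l_coset_eq_iff[OF H, of g "g \<otimes> h"] HG topspace_eq by (auto simp: m_assoc[symmetric])
    then show "g <# H \<in> (\<lambda>g. g <# H) ` U" using * by blast
  qed
  moreover have "openin T {g \<in> topspace T. g \<otimes> h \<in> U}" if "h \<in> H" for h
  proof (rule openin_continuous_map_preimage[OF _ U])
    show "continuous_map T T (\<lambda>g. g \<otimes> h)"
      using that HG topspace_eq by (intro continuous_map_mult) auto
  qed
  ultimately show "openin T {g \<in> topspace T. g <# H \<in> (\<lambda>g. g <# H) ` U}" by auto
qed

text \<open>For distinct cosets of \<open>a\<close> and \<open>b\<close>, the element
  \<open>inv a \<otimes> b\<close> lies outside the closed set \<open>H\<close>. By continuity this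
  persists on a box \<open>U \<times> V\<close> around \<open>(a, b)\<close>, so that
  \<open>U\<close> and \<open>V\<close> have disjoint images.\<close>

lemma Hausdorff_coset_topology:
  assumes H: "closed_subgroup H G T"
  shows "Hausdorff_space (coset_topology G T H)"
  unfolding Hausdorff_space_def
proof (intro allI impI, elim conjE)
  have sH: "subgroup H G" and cH: "closedin T H" using H by (auto simp: closed_subgroup_def)
  let ?\<pi> = "\<lambda>g. g <# H"
  fix A B assume AB: "A \<in> topspace (coset_topology G T H)" "B \<in> topspace (coset_topology G T H)"
    "A \<noteq> B"
  then obtain a b where ab: "a \<in> carrier G" "b \<in> carrier G" "A = ?\<pi> a" "B = ?\<pi> b"
    by (auto simp: topspace_coset_topology LCOSETS_def)
  let ?f = "\<lambda>p. inv (fst p) \<otimes> snd p"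
  define W where "W = {p \<in> topspace (prod_topology T T). ?f p \<in> topspace T - H}"
  have "openin (prod_topology T T) W"
    unfolding W_def
  proof (rule openin_continuous_map_preimage)
    show "continuous_map (prod_topology T T) T ?f"
      by (intro continuous_map_mult continuous_map_m_inv continuous_map_fst continuous_map_snd)
    show "openin T (topspace T - H)" using cH by blast
  qed
  moreover have "(a, b) \<in> W"
    using ab AB(3) l_coset_eq_iff[OF sH ab(1,2)] by (auto simp: topspace_eq W_def)
  ultimately obtain U V where UV: "openin T U" "openin T V" "a \<in> U" "b \<in> V" "U \<times> V \<subseteq> W"
    unfolding openin_prod_topology_alt by metis
  have UVG: "U \<subseteq> carrier G" "V \<subseteq> carrier G" using UV openin_subset topspace_eq by blast+
  have "disjnt (?\<pi> ` U) (?\<pi> ` V)"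
  proof (rule ccontr)
    assume "\<not> disjnt (?\<pi> ` U) (?\<pi> ` V)"
    then obtain u v where uv: "u \<in> U" "v \<in> V" "?\<pi> u = ?\<pi> v" unfolding disjnt_def by blast
    then have "inv u \<otimes> v \<in> H" using l_coset_eq_iff[OF sH] UVG by blast
    moreover have "(u, v) \<in> W" using UV(5) uv by blast
    ultimately show False by (simp add: W_def)
  qed
  moreover have "openin (coset_topology G T H) (?\<pi> ` U)" "openin (coset_topology G T H) (?\<pi> ` V)"
    using open_map_coset[OF sH] UV unfolding open_map_def by auto
  ultimately show "\<exists>U V. openin (coset_topology G T H) U \<and> openin (coset_topology G T H) V \<and>
      A \<in> U \<and> B \<in> V \<and> disjnt U V"
    using ab UV(3,4) by blast
qed

lemma topological_group_subgroup:
  assumes L: "subgroup L G"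
  shows "topological_group (G\<lparr>carrier := L\<rparr>) (subtopology T L)"
proof -
  have LG: "L \<subseteq> carrier G" using L by (rule subgroup.subset)
  have cl: "continuous_map X (subtopology T L) f"
    if "continuous_map X T f" "f \<in> topspace X \<rightarrow> L" for X :: "'c topology" and f
    using that by (simp add: continuous_map_in_subtopology image_subset_iff_funcset)
  interpret L: group "G\<lparr>carrier := L\<rparr>" using subgroup_imp_group[OF L] .
  have top: "topspace (subtopology T L) = L" using LG topspace_eq by auto
  show ?thesis
  proof
    show "topspace (subtopology T L) = carrier (G\<lparr>carrier := L\<rparr>)" using top by simp
    have "continuous_map (prod_topology (subtopology T L) (subtopology T L)) T (\<lambda>p. fst p \<otimes> snd p)"
      by (intro continuous_map_mult continuous_map_into_fulltopology[OF continuous_map_fst]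
            continuous_map_into_fulltopology[OF continuous_map_snd])
    then show "continuous_map (prod_topology (subtopology T L) (subtopology T L)) (subtopology T L)
        (\<lambda>(x, y). x \<otimes>\<^bsub>G\<lparr>carrier := L\<rparr>\<^esub> y)"
      using subgroup.m_closed[OF L] top by (intro cl) (auto simp: case_prod_unfold)
    have "continuous_map (subtopology T L) (subtopology T L) (\<lambda>x. inv x)"
      using subgroup.m_inv_closed[OF L] top
      by (intro cl continuous_map_from_subtopology continuous_inv) auto
    \<comment> \<open>The inverse operations of the subgroup and of \<open>G\<close> agree on
      \<open>L\<close>, which is all of this subspace.\<close>
    then show "continuous_map (subtopology T L) (subtopology T L) (\<lambda>x. inv\<^bsub>G\<lparr>carrier := L\<rparr>\<^esub> x)"
      by (rule continuous_map_eq) (use m_inv_consistent[OF L] top in auto)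
  qed
qed

lemma coset_action_closed:
  assumes "subgroup L G" "l \<in> L" "A \<in> lcosets H" "H \<subseteq> carrier G"
  shows "l <# A \<in> lcosets H"
proof -
  obtain a where "a \<in> carrier G" "A = a <# H" using assms(3) by (auto simp: LCOSETS_def)
  moreover have "l \<in> carrier G" using subgroup.mem_carrier[OF assms(1,2)] .
  ultimately show ?thesis using assms(4) by (auto simp: LCOSETS_def lcos_m_assoc)
qed

text \<open>Associativity of translation gives the homomorphism law and makes translation by
  \<open>inv l\<close> inverse to translation by \<open>l\<close>.\<close>

lemma group_action_coset_action:
  assumes L: "subgroup L G" and H: "subgroup H G"
  shows "group_action (G\<lparr>carrier := L\<rparr>) (lcosets H) (coset_action G H)"
proof -
  interpret L: group "G\<lparr>carrier := L\<rparr>" using subgroup_imp_group[OF L] .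
  have HG: "H \<subseteq> carrier G" and LG: "L \<subseteq> carrier G" using H L subgroup.subset by blast+
  have sub: "A \<subseteq> carrier G" if "A \<in> lcosets H" for A
    using that HG by (auto simp: LCOSETS_def l_coset_def)
  note cl = coset_action_closed[OF L _ _ HG]
  have comp: "l <# (m <# A) = (l \<otimes> m) <# A" if "l \<in> L" "m \<in> L" "A \<in> lcosets H" for l m A
    using lcos_m_assoc[OF sub[OF that(3)]] subsetD[OF LG that(1)] subsetD[OF LG that(2)] by simp
  have "coset_action G H l \<in> Bij (lcosets H)" if l: "l \<in> L" for l
  proof -
    have il: "inv l \<in> L" using L l by (simp add: subgroup.m_inv_closed)
    have "bij_betw (coset_action G H l) (lcosets H) (lcosets H)"
    proof (rule bij_betwI[where g = "coset_action G H (inv l)"])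
      show "coset_action G H l \<in> lcosets H \<rightarrow> lcosets H"
        "coset_action G H (inv l) \<in> lcosets H \<rightarrow> lcosets H"
        using cl l il by (auto simp: coset_action_def)
      fix A assume A: "A \<in> lcosets H"
      have lG: "l \<in> carrier G" using l LG by blast
      show "coset_action G H (inv l) (coset_action G H l A) = A"
        using A cl[OF l A] comp[OF il l A] lG sub[OF A] lcos_mult_one by (simp add: coset_action_def)
      show "coset_action G H l (coset_action G H (inv l) A) = A"
        using A cl[OF il A] comp[OF l il A] lG sub[OF A] lcos_mult_one by (simp add: coset_action_def)
    qed
    \<comment> \<open>\<open>Bij\<close> asks for extensional functions; the restriction to cosets
      built into \<open>coset_action\<close> provides this.\<close>
    then show ?thesis by (simp add: Bij_def coset_action_def)
  qed
  moreover have "coset_action G H (l \<otimes> m) = compose (lcosets H) (coset_action G H l) (coset_action G H m)"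
    if "l \<in> L" "m \<in> L" for l m
    using that comp cl by (auto simp: coset_action_def compose_def fun_eq_iff)
  ultimately have hom: "coset_action G H \<in> hom (G\<lparr>carrier := L\<rparr>) (BijGroup (lcosets H))"
    by (auto simp: hom_def BijGroup_def)
  show ?thesis
  proof (rule group_action.intro, rule group_hom.intro)
    show "group (G\<lparr>carrier := L\<rparr>)" using subgroup_imp_group[OF L] .
    show "group (BijGroup (lcosets H))" by (rule group_BijGroup)
    show "group_hom_axioms (G\<lparr>carrier := L\<rparr>) (BijGroup (lcosets H)) (coset_action G H)"
      using hom by (rule group_hom_axioms.intro)
  qed
qed

end

section \<open>Local compactness, continuity and properness of the action on cosets\<close>

context lch_group
begin


text \<open>Closedness enters through local compactness, which passes to closed subspaces.\<close>

lemma lch_group_subgroup: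
  assumes L: "closed_subgroup L G T"
  shows "lch_group (G\<lparr>carrier := L\<rparr>) (subtopology T L)"
  unfolding lch_group_def lch_group_axioms_def
proof (intro conjI)
  have "subgroup L G" using L by (simp add: closed_subgroup_def)
  then show "topological_group (G\<lparr>carrier := L\<rparr>) (subtopology T L)"
    by (rule topological_group_subgroup)
  show "Hausdorff_space (subtopology T L)" using Hausdorff by (rule Hausdorff_space_subtopology)
  have "closedin T L" using L by (simp add: closed_subgroup_def)
  then show "locally_compact_space (subtopology T L)"
    by (rule locally_compact_space_closed_subset[OF locally_compact])
qed

lemma locally_compact_coset_topology:
  assumes "subgroup H G"
  shows "locally_compact_space (coset_topology G T H)"
proof (rule locally_compact_space_continuous_open_map_image)
  show "continuous_map T (coset_topology G T H) (\<lambda>g. g <# H)"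
    by (rule quotient_imp_continuous_map[OF quotient_map_coset_topology])
  show "open_map T (coset_topology G T H) (\<lambda>g. g <# H)"
    by (rule open_map_coset[OF assms])
  show "(\<lambda>g. g <# H) ` topspace T = topspace (coset_topology G T H)"
    by (rule quotient_imp_surjective_map[OF quotient_map_coset_topology])
qed (rule locally_compact)

text \<open>Before passing to cosets the action is multiplication of \<open>L\<close> with
  \<open>G\<close>, which is continuous; continuity then descends along a quotient map.\<close>

lemma continuous_action_coset_action:
  assumes L: "closed_subgroup L G T" and H: "subgroup H G"
  shows "continuous_action (G\<lparr>carrier := L\<rparr>) (subtopology T L) (coset_topology G T H) (coset_action G H)"
proof -
  have sL: "subgroup L G" and LG: "L \<subseteq> carrier G" and HG: "H \<subseteq> carrier G"
    using L H subgroup.subset by (auto simp: closed_subgroup_def)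
  interpret L: lch_group "G\<lparr>carrier := L\<rparr>" "subtopology T L" using lch_group_subgroup[OF L] .
  let ?S = "coset_topology G T H" and ?T = "subtopology T L"
  \<comment> \<open>The product of an identity with a quotient map need not be a quotient map; it is
    one here because \<open>L\<close> is locally compact and Hausdorff.\<close>
  have q: "quotient_map (prod_topology ?T T) (prod_topology ?T ?S) (\<lambda>(l, g). (l, g <# H))"
    using L.Hausdorff by (intro quotient_map_prod_right[OF L.locally_compact _ quotient_map_coset_topology]) simp
  have "continuous_map (prod_topology ?T T) T (\<lambda>p. fst p \<otimes> snd p)"
    by (intro continuous_map_mult continuous_map_into_fulltopology[OF continuous_map_fst]
          continuous_map_snd)
  from continuous_map_compose[OF this quotient_imp_continuous_map[OF quotient_map_coset_topology]]
  have "continuous_map (prod_topology ?T T) ?S (\<lambda>p. (fst p \<otimes> snd p) <# H)"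
    by (simp add: o_def)
  then have "continuous_map (prod_topology ?T T) ?S
      ((\<lambda>(l, A). coset_action G H l A) \<circ> (\<lambda>(l, g). (l, g <# H)))"
  proof (rule continuous_map_eq)
    fix p assume "p \<in> topspace (prod_topology ?T T)"
    then have p: "fst p \<in> carrier G" "snd p \<in> carrier G" using LG by (auto simp: topspace_eq)
    then have "snd p <# H \<in> lcosets H" by (auto simp: LCOSETS_def)
    then show "(fst p \<otimes> snd p) <# H = ((\<lambda>(l, A). coset_action G H l A) \<circ> (\<lambda>(l, g). (l, g <# H))) p"
      using lcos_m_assoc[OF HG p] by (simp add: coset_action_def case_prod_unfold)
  qed
  then have "continuous_map (prod_topology ?T ?S) ?S (\<lambda>(l, A). coset_action G H l A)"
    using continuous_compose_quotient_map_eq[OF q] by blast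
  then show ?thesis
    unfolding continuous_action_def topspace_coset_topology
    using group_action_coset_action[OF sL H] by simp
qed

text \<open>The preimage of \<open>K\<close> is a closed subset of the compact set
  \<open>(D \<inter> L) \<times> ?K1\<close>.\<close>

lemma proper_action_coset_action:
  assumes L: "closed_subgroup L G T" and H: "closed_subgroup H G T"
    and LH: "\<And>C. compactin T C \<Longrightarrow> \<exists>D. compactin T D \<and>
      {c \<otimes> h \<otimes> inv d | c h d. c \<in> C \<and> h \<in> H \<and> d \<in> C} \<inter> L \<subseteq> D"
  shows "proper_action (G\<lparr>carrier := L\<rparr>) (subtopology T L) (coset_topology G T H) (coset_action G H)"
  unfolding proper_action_def
proof (intro conjI allI impI)
  let ?S = "coset_topology G T H" and ?T = "subtopology T L"
  let ?\<pi> = "\<lambda>g. g <# H" and ?\<phi> = "coset_action G H"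
  have sH: "subgroup H G" and cL: "closedin T L" and sL: "subgroup L G"
    using L H by (auto simp: closed_subgroup_def)
  have HG: "H \<subseteq> carrier G" and LG: "L \<subseteq> carrier G" using sH sL subgroup.subset by blast+
  show "lch_group (G\<lparr>carrier := L\<rparr>) ?T" using L by (rule lch_group_subgroup)
  show HS: "Hausdorff_space ?S" using H by (rule Hausdorff_coset_topology)
  show "locally_compact_space ?S" using sH by (rule locally_compact_coset_topology)
  show act: "continuous_action (G\<lparr>carrier := L\<rparr>) ?T ?S ?\<phi>"
    using L sH by (rule continuous_action_coset_action)
  fix K assume K: "compactin (prod_topology ?S ?S) K"
  let ?K1 = "fst ` K" and ?K2 = "snd ` K"
  have K1: "compactin ?S ?K1" and K2: "compactin ?S ?K2"
    using image_compactin[OF K continuous_map_fst] image_compactin[OF K continuous_map_snd] .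
  have "(\<lambda>g. g <# H) ` topspace T = topspace ?S"
    by (rule quotient_imp_surjective_map[OF quotient_map_coset_topology])
  \<comment> \<open>One compact \<open>C\<close> represents the cosets in both projections of
    \<open>K\<close>.\<close>
  then obtain C where C: "compactin T C" "?K1 \<union> ?K2 \<subseteq> ?\<pi> ` C"
    using compactin_lift_open_map[OF locally_compact open_map_coset[OF sH] _ compactin_Un[OF K1 K2]]
    by metis
  have CG: "C \<subseteq> carrier G" using C(1) compactin_subset_topspace topspace_eq by blast
  obtain D where D: "compactin T D"
    "{c \<otimes> h \<otimes> inv d | c h d. c \<in> C \<and> h \<in> H \<and> d \<in> C} \<inter> L \<subseteq> D"
    using LH[OF C(1)] by blast
  let ?P = "{(g, x). g \<in> topspace ?T \<and> x \<in> topspace ?S \<and> (x, ?\<phi> g x) \<in> K}"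
  have "compactin ?T (D \<inter> L)"
    using compact_Int_closedin[OF D(1) cL] by (simp add: compactin_subtopology)
  then have "compactin (prod_topology ?T ?S) ((D \<inter> L) \<times> ?K1)"
    using K1 by (simp add: compactin_Times)
  moreover have "?P \<subseteq> (D \<inter> L) \<times> ?K1"
  proof clarify
    fix l A assume l: "l \<in> topspace ?T" and A: "A \<in> topspace ?S" "(A, ?\<phi> l A) \<in> K"
    have lL: "l \<in> L" "l \<in> carrier G" using l LG by auto
    have AK: "A \<in> ?K1" "?\<phi> l A \<in> ?K2"
      using imageI[OF A(2), of fst] imageI[OF A(2), of snd] by simp_all
    then have "A \<in> ?\<pi> ` C" "?\<phi> l A \<in> ?\<pi> ` C" using C(2) by auto
    then obtain d c where cd: "d \<in> C" "A = d <# H" "c \<in> C" "?\<phi> l A = c <# H" by blast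
    then have cdG: "c \<in> carrier G" "d \<in> carrier G" using CG by auto
    have "(l \<otimes> d) <# H = c <# H"
      using cd A(1) lL cdG HG by (simp add: coset_action_def topspace_coset_topology lcos_m_assoc)
    then have "inv c \<otimes> (l \<otimes> d) \<in> H"
      using l_coset_eq_iff[OF sH, of c "l \<otimes> d"] lL cdG by simp
    \<comment> \<open>With \<open>h = inv c \<otimes> (l \<otimes> d)\<close> in \<open>H\<close>,
      this puts \<open>l\<close> into the set that \<open>D\<close> contains.\<close>
    moreover have "l = c \<otimes> (inv c \<otimes> (l \<otimes> d)) \<otimes> inv d"
      using lL cdG by (simp add: m_assoc m_assoc[symmetric, of c "inv c"])
    ultimately have "l \<in> D" using D(2) cd lL by blast
    then show "l \<in> D \<inter> L \<and> A \<in> ?K1" using lL AK(1) by simp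
  qed
  moreover have "closedin (prod_topology ?T ?S) ?P"
  proof -
    \<comment> \<open>Compact sets are closed because the coset space is Hausdorff.\<close>
    have KS: "closedin (prod_topology ?S ?S) K"
      using compactin_imp_closedin[OF _ K] HS by (simp add: Hausdorff_space_prod_topology)
    have "continuous_map (prod_topology ?T ?S) (prod_topology ?S ?S) (\<lambda>p. (snd p, ?\<phi> (fst p) (snd p)))"
      using act by (simp add: continuous_map_paired continuous_map_snd continuous_action_def
          case_prod_unfold)
    from closedin_continuous_map_preimage[OF this KS] show ?thesis
      by (rule back_subst) auto
  qed
  ultimately show "compactin (prod_topology ?T ?S) ?P"
    by (rule closed_compactin)
qed

end

section \<open>Bounded sets of the LR-coarse structure and properness from a coarse map\<close>

context topological_group
begin

text \<open>Comparing all points with one base point \<open>a\<close> places a bounded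
  \<open>A\<close> inside \<open>C a C^-1\<close>, a continuous image of
  \<open>C \<times> C\<close>. This translates coarse properness into a compactness
  statement.\<close>

lemma coarsely_bounded_LR_coarse_iff:
  assumes A: "A \<subseteq> carrier G"
  shows "coarsely_bounded (LR_coarse G T) A \<longleftrightarrow> (\<exists>D. compactin T D \<and> A \<subseteq> D)"
proof
  assume bdd: "coarsely_bounded (LR_coarse G T) A"
  show "\<exists>D. compactin T D \<and> A \<subseteq> D"
  proof (cases "A = {}")
    case True
    then show ?thesis using compactin_empty by blast
  next
    case False
    then obtain a where a: "a \<in> A" "a \<in> carrier G" using A by blast
    obtain C where C: "compactin T C"
      "\<forall>(x, y)\<in>A \<times> A. \<exists>c\<in>C. \<exists>d\<in>C. x = c \<otimes> y \<otimes> inv d"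
      using bdd unfolding coarsely_bounded_def LR_coarse_iff by blast
    let ?f = "\<lambda>p. fst p \<otimes> a \<otimes> inv (snd p)"
    have "compactin (prod_topology T T) (C \<times> C)" using C(1) by (simp add: compactin_Times)
    moreover have "continuous_map (prod_topology T T) T ?f"
      using a(2) topspace_eq
      by (intro continuous_map_mult continuous_map_m_inv continuous_map_fst continuous_map_snd) auto
    ultimately have "compactin T (?f ` (C \<times> C))" by (rule image_compactin)
    moreover have "A \<subseteq> ?f ` (C \<times> C)"
    proof
      fix x assume "x \<in> A"
      then obtain c d where "c \<in> C" "d \<in> C" "x = c \<otimes> a \<otimes> inv d" using C(2) a(1) by blast
      then show "x \<in> ?f ` (C \<times> C)" by (intro image_eqI[of _ _ "(c, d)"]) auto
    qed
    ultimately show ?thesis by blast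
  qed
next
  assume "\<exists>D. compactin T D \<and> A \<subseteq> D"
  then obtain D where D: "compactin T D" "A \<subseteq> D" by blast
  \<comment> \<open>the two factors from \<open>D\<close> are \<open>x\<close> and \<open>y\<close> themselves\<close>
  have "x = x \<otimes> y \<otimes> inv y" if "x \<in> A" "y \<in> A" for x y
    using that A subsetD[OF A] by (simp add: m_assoc)
  then have "\<forall>(x, y)\<in>A \<times> A. \<exists>c\<in>D. \<exists>d\<in>D. x = c \<otimes> y \<otimes> inv d"
    using D(2) by blast
  then show "coarsely_bounded (LR_coarse G T) A"
    unfolding coarsely_bounded_def LR_coarse_iff using A D(1) by blast
qed

end

text \<open>An element \<open>x = c \<otimes> h \<otimes> inv d\<close> of \<open>L\<close> is
  related to \<open>h\<close> by an entourage depending only on \<open>C\<close>. Hence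
  \<open>\<mu> x\<close> lies in the part \<open>B\<close> of the image of \<open>L\<close> near the
  image of \<open>H\<close>. This \<open>B\<close> is bounded, and coarse properness confines
  \<open>x\<close> to a compact set.\<close>

lemma (in lch_group) proper_action_if_asymptotically_disjoint:
  assumes L: "closed_subgroup L G T" and H: "closed_subgroup H G T"
    and \<mu>: "coarse_map (carrier G) (LR_coarse G T) S \<F> \<mu>"
    and disj: "asymptotically_disjoint S \<F> (\<mu> ` L) (\<mu> ` H)"
  shows "proper_action (G\<lparr>carrier := L\<rparr>) (subtopology T L) (coset_topology G T H) (coset_action G H)"
  using L H
proof (rule proper_action_coset_action)
  have LG: "L \<subseteq> carrier G" and HG: "H \<subseteq> carrier G"
    using L H subgroup.subset by (auto simp: closed_subgroup_def)
  fix C assume C: "compactin T C"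
  then have CG: "C \<subseteq> carrier G" using compactin_subset_topspace topspace_eq by blast
  \<comment> \<open>The largest entourage witnessed by \<open>C\<close>.\<close>
  define E where "E = {(x, y). x \<in> carrier G \<and> y \<in> carrier G \<and> (\<exists>c\<in>C. \<exists>d\<in>C. x = c \<otimes> y \<otimes> inv d)}"
  define F where "F = {(\<mu> x, \<mu> y) | x y. (x, y) \<in> E}"
  define B where "B = \<mu> ` L \<inter> thickening F (\<mu> ` H)"
  have "E \<subseteq> carrier G \<times> carrier G" by (auto simp: E_def)
  moreover have "\<forall>(x, y)\<in>E. \<exists>c\<in>C. \<exists>d\<in>C. x = c \<otimes> y \<otimes> inv d" by (auto simp: E_def)
  ultimately have "E \<in> LR_coarse G T" unfolding LR_coarse_iff using C by blast
  then have "F \<in> \<F>" using \<mu> unfolding coarse_map_def controlled_map_def F_def by blast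
  then have "coarsely_bounded \<F> B" "B \<subseteq> S"
    using disj unfolding asymptotically_disjoint_def B_def by blast+
  then have "coarsely_bounded (LR_coarse G T) {x \<in> carrier G. \<mu> x \<in> B}"
    using \<mu> unfolding coarse_map_def coarsely_proper_map_def by blast
  then obtain D where D: "compactin T D" "{x \<in> carrier G. \<mu> x \<in> B} \<subseteq> D"
    using coarsely_bounded_LR_coarse_iff[of "{x \<in> carrier G. \<mu> x \<in> B}"] by auto
  have "x \<in> D" if x: "x \<in> L" "x = c \<otimes> h \<otimes> inv d" "c \<in> C" "h \<in> H" "d \<in> C" for x c h d
  proof -
    have G: "x \<in> carrier G" "h \<in> carrier G" using x LG HG by auto
    then have "(x, h) \<in> E" using x by (auto simp: E_def)
    then have "(\<mu> x, \<mu> h) \<in> F" by (auto simp: F_def)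
    then have "\<mu> x \<in> B" using x by (auto simp: B_def thickening_def)
    then show ?thesis using D(2) G by blast
  qed
  then have "{c \<otimes> h \<otimes> inv d | c h d. c \<in> C \<and> h \<in> H \<and> d \<in> C} \<inter> L \<subseteq> D" by auto
  with D(1) show "\<exists>D. compactin T D \<and> {c \<otimes> h \<otimes> inv d | c h d. c \<in> C \<and> h \<in> H \<and> d \<in> C} \<inter> L \<subseteq> D"
    by (intro exI conjI)
qed

section \<open>Minors\<close>

text \<open>Selecting rows and columns by arbitrary index functions, which may repeat or permute them,
  keeps the multilinear expansion of \<open>fdet\<close> free of signs.\<close>

definition fdet :: "nat \<Rightarrow> (nat \<Rightarrow> nat \<Rightarrow> 'a::comm_ring_1) \<Rightarrow> 'a" where
  "fdet q M = Determinant.det (mat q q (\<lambda>(a, b). M a b))"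

lemma fdet_cong:
  "(\<And>a b. a < q \<Longrightarrow> b < q \<Longrightarrow> M a b = N a b) \<Longrightarrow> fdet q M = fdet q N"
  unfolding fdet_def by (intro arg_cong[of _ _ Determinant.det] eq_matI) auto

lemma fdet_leibniz:
  "fdet q M = (\<Sum>p | p permutes {0..<q}. signof p * (\<Prod>i = 0..<q. M i (p i)))"
proof -
  have "fdet q M = (\<Sum>p | p permutes {0..<q}. signof p *
      (\<Prod>i = 0..<q. mat q q (\<lambda>(a, b). M a b) $$ (i, p i)))"
    unfolding fdet_def by (rule det_def') simp
  also have "\<dots> = (\<Sum>p | p permutes {0..<q}. signof p * (\<Prod>i = 0..<q. M i (p i)))"
    by (intro sum.cong refl arg_cong[of _ _ "\<lambda>x. _ * x"] prod.cong)
      (auto simp: permutes_in_image[of _ "{0..<q}", simplified])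
  finally show ?thesis .
qed

text \<open>Makes the row lemmas available for columns.\<close>

lemma fdet_transpose: "fdet q (\<lambda>a b. M b a) = fdet q M"
proof -
  have "mat q q (\<lambda>(a, b). M b a) = transpose_mat (mat q q (\<lambda>(a, b). M a b))"
    by (rule eq_matI) auto
  then show ?thesis unfolding fdet_def using det_transpose[of "mat q q (\<lambda>(a, b). M a b)" q] by simp
qed

lemma fdet_permute:
  assumes p: "p permutes {0..<q}"
  shows "fdet q (\<lambda>a. M (p a)) = signof p * fdet q M"
proof -
  have "fdet q (\<lambda>a. M (p a)) = Determinant.det (mat q q (\<lambda>(i, j). mat q q (\<lambda>(a, b). M a b) $$ (p i, j)))"
    unfolding fdet_def by (intro arg_cong[of _ _ Determinant.det] eq_matI)
      (use permutes_in_image[OF p] in auto)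
  also have "\<dots> = signof p * fdet q M"
    unfolding fdet_def by (rule det_permute_rows[OF _ p]) simp
  finally show ?thesis .
qed

lemma fdet_eq_0:
  assumes "a < q" "b < q" "a \<noteq> b" "M a = M b"
  shows "fdet q M = 0"
  unfolding fdet_def
  by (rule det_identical_rows[of _ q a b]) (use assms in \<open>auto simp: row_mat\<close>)

text \<open>Multilinearity in all rows at once: a product of sums is a sum over choice functions
  \<open>f\<close>, where \<open>f a\<close> names the row of \<open>M\<close> used in place
  \<open>a\<close>.\<close>

lemma fdet_sum:
  assumes "finite S"
  shows "fdet q (\<lambda>a b. \<Sum>k\<in>S. u a k * M k b) =
    (\<Sum>f\<in>{0..<q} \<rightarrow>\<^sub>E S. (\<Prod>a = 0..<q. u a (f a)) * fdet q (\<lambda>a. M (f a)))"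
proof -
  have "fdet q (\<lambda>a b. \<Sum>k\<in>S. u a k * M k b) =
      (\<Sum>p | p permutes {0..<q}. signof p * (\<Sum>f\<in>{0..<q} \<rightarrow>\<^sub>E S. \<Prod>i = 0..<q. u i (f i) * M (f i) (p i)))"
    unfolding fdet_leibniz using assms by (subst prod_sum_PiE) auto
  also have "\<dots> = (\<Sum>p | p permutes {0..<q}. \<Sum>f\<in>{0..<q} \<rightarrow>\<^sub>E S.
      (\<Prod>a = 0..<q. u a (f a)) * (signof p * (\<Prod>i = 0..<q. M (f i) (p i))))"
    by (simp add: sum_distrib_left prod.distrib mult.left_commute)
  also have "\<dots> = (\<Sum>f\<in>{0..<q} \<rightarrow>\<^sub>E S. \<Sum>p | p permutes {0..<q}.
      (\<Prod>a = 0..<q. u a (f a)) * (signof p * (\<Prod>i = 0..<q. M (f i) (p i))))"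
    by (rule sum.swap)
  finally show ?thesis by (simp add: fdet_leibniz sum_distrib_left)
qed

text \<open>Replaces the Cauchy--Binet formula: one factor of the product only enters through the size of
  its entries.\<close>

lemma abs_fdet_sum_le:
  fixes u M :: "nat \<Rightarrow> nat \<Rightarrow> real"
  assumes u: "\<And>a k. a < q \<Longrightarrow> k < m \<Longrightarrow> \<bar>u a k\<bar> \<le> r"
    and M: "\<And>f. f \<in> {0..<q} \<rightarrow> {..<m} \<Longrightarrow> \<bar>fdet q (\<lambda>a. M (f a))\<bar> \<le> B"
  shows "\<bar>fdet q (\<lambda>a b. \<Sum>k<m. u a k * M k b)\<bar> \<le> (real m * r) ^ q * B"
proof -
  have "\<bar>fdet q (\<lambda>a b. \<Sum>k<m. u a k * M k b)\<bar> \<le>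
      (\<Sum>f\<in>{0..<q} \<rightarrow>\<^sub>E {..<m}. \<bar>(\<Prod>a = 0..<q. u a (f a)) * fdet q (\<lambda>a. M (f a))\<bar>)"
    unfolding fdet_sum[OF finite_lessThan] by (rule sum_abs)
  also have "\<dots> \<le> (\<Sum>f\<in>{0..<q} \<rightarrow>\<^sub>E {..<m}. r ^ q * B)"
  proof (rule sum_mono)
    fix f assume f: "f \<in> {0..<q} \<rightarrow>\<^sub>E {..<m}"
    then have fM: "\<bar>fdet q (\<lambda>a. M (f a))\<bar> \<le> B" by (intro M) auto
    have "(\<Prod>a = 0..<q. \<bar>u a (f a)\<bar>) \<le> (\<Prod>a = 0..<q. r)"
      using f by (intro prod_mono) (auto intro!: u)
    then have "\<bar>\<Prod>a = 0..<q. u a (f a)\<bar> \<le> r ^ q" by (simp add: abs_prod)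
    then show "\<bar>(\<Prod>a = 0..<q. u a (f a)) * fdet q (\<lambda>a. M (f a))\<bar> \<le> r ^ q * B"
      \<comment> \<open>Both \<open>r ^ q\<close> and \<open>B\<close> are nonnegative because they
        bound absolute values.\<close>
      unfolding abs_mult using fM by (intro mult_mono) (auto intro: order_trans[OF abs_ge_zero])
  qed
  \<comment> \<open>There are \<open>m ^ q\<close> choice functions.\<close>
  also have "\<dots> = (real m * r) ^ q * B"
    by (simp add: card_PiE power_mult_distrib)
  finally show ?thesis .
qed

text \<open>Listing the selected rows in increasing order permutes them, which costs only a
  sign.\<close>

lemma abs_fdet_pick:
  fixes M :: "nat \<Rightarrow> nat \<Rightarrow> real"
  assumes f: "inj_on f {..<q}"
  shows "\<bar>fdet q (\<lambda>a. M (f a))\<bar> = \<bar>fdet q (\<lambda>a. M (pick (f ` {..<q}) a))\<bar>"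
proof -
  let ?I = "f ` {..<q}"
  \<comment> \<open>\<open>p a\<close> is the rank of \<open>f a\<close> in the image, and
    \<open>pick\<close> undoes it. Outside \<open>{0..<q}\<close> it is the identity, as
    \<open>permutes\<close> demands.\<close>
  define p where "p a = (if a \<in> {0..<q} then card {x \<in> ?I. x < f a} else a)" for a
  have cI: "card ?I = q" using f by (simp add: card_image)
  have pf: "pick ?I (p a) = f a" if "a < q" for a
    using that pick_card_in_set[of "f a" ?I] by (simp add: p_def)
  have plt: "p a < q" if "a < q" for a
  proof -
    have "{x \<in> ?I. x < f a} \<subset> ?I" using that by blast
    then have "card {x \<in> ?I. x < f a} < card ?I" by (intro psubset_card_mono) auto
    then show ?thesis using that cI by (simp add: p_def)
  qed
  have inj: "inj_on p {0..<q}"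
  proof (rule inj_onI)
    fix a b assume "a \<in> {0..<q}" "b \<in> {0..<q}" "p a = p b"
    then show "a = b" using pf[of a] pf[of b] inj_onD[OF f, of a b] by auto
  qed
  have "p ` {0..<q} = {0..<q}"
    using inj plt by (intro card_subset_eq) (auto simp: card_image)
  then have "p permutes {0..<q}"
    using inj by (intro bij_imp_permutes) (auto simp: bij_betw_def p_def)
  then have "fdet q (\<lambda>a. M (pick ?I (p a))) = signof p * fdet q (\<lambda>a. M (pick ?I a))"
    by (rule fdet_permute)
  moreover have "fdet q (\<lambda>a. M (pick ?I (p a))) = fdet q (\<lambda>a. M (f a))"
    by (rule fdet_cong) (simp add: pf)
  moreover have "\<bar>signof p :: real\<bar> = 1" by (simp add: sign_def)
  ultimately show ?thesis by (simp add: abs_mult)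
qed

section \<open>The norm of an exterior power\<close>

text \<open>\<open>max_norm\<close> depends only on the set of entries, so minors can be collected
  over pairs of subsets without their lexicographic numbering. The row count also bounds the column
  indices, the matrices being square.\<close>

definition minors :: "nat \<Rightarrow> real mat \<Rightarrow> real set" where
  "minors q A = {fdet q (\<lambda>a b. A $$ (pick I a, pick J b)) | I J.
     I \<subseteq> {..<dim_row A} \<and> J \<subseteq> {..<dim_row A} \<and> card I = q \<and> card J = q}"

lemma set_lex_lists_image: "set ` set (lex_lists m q) = {I. I \<subseteq> {..<m} \<and> card I = q}"
proof (intro equalityI subsetI)
  fix I assume I: "I \<in> {I. I \<subseteq> {..<m} \<and> card I = q}"
  then have "finite I" using finite_subset by blast
  with I show "I \<in> set ` set (lex_lists m q)"
    by (intro image_eqI[of _ _ "sorted_list_of_set I"]) (auto simp: set_lex_lists)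
qed (auto simp: set_lex_lists strict_sorted_iff distinct_card)

lemma det_submatrix:
  assumes A: "A \<in> carrier_mat m m" and I: "I \<subseteq> {..<m}" "card I = q" and J: "J \<subseteq> {..<m}" "card J = q"
  shows "Determinant.det (submatrix A I J) = fdet q (\<lambda>a b. A $$ (pick I a, pick J b))"
proof -
  \<comment> \<open>\<open>submatrix\<close> sizes its result by the selected indices that lie
    inside the matrix, here all of them.\<close>
  have "{i. i < m \<and> i \<in> I} = I" "{i. i < m \<and> i \<in> J} = J" using I J by auto
  then show ?thesis using A I J by (simp add: submatrix_def fdet_def)
qed

text \<open>The lists in \<open>lex_lists\<close> run through all \<open>q\<close>-element subsets,
  so matrix positions and pairs of subsets correspond.\<close>

lemma elements_exterior_power:
  assumes A: "A \<in> carrier_mat m m"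
  shows "elements_mat (exterior_power q A) = minors q A"
proof -
  let ?L = "lex_lists m q" and ?m = "\<lambda>I J. fdet q (\<lambda>a b. A $$ (pick I a, pick J b))"
  have N: "m choose q = length ?L" by (simp add: length_lex_lists)
  have car: "exterior_power q A \<in> carrier_mat (length ?L) (length ?L)"
    using A by (simp add: exterior_power_def Let_def N)
  have L: "set (?L ! a) \<subseteq> {..<m}" "card (set (?L ! a)) = q" if "a < length ?L" for a
    using imageI[OF nth_mem[OF that], of set] unfolding set_lex_lists_image by auto
  have entry: "exterior_power q A $$ (a, b) = ?m (set (?L ! a)) (set (?L ! b))"
    if "a < length ?L" "b < length ?L" for a b
    using that A det_submatrix[OF A L[OF that(1)] L[OF that(2)]]
    by (simp add: exterior_power_def Let_def N)
  show ?thesis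
  proof (intro equalityI subsetI)
    fix x assume "x \<in> elements_mat (exterior_power q A)"
    then obtain a b where ab: "a < length ?L" "b < length ?L" "x = exterior_power q A $$ (a, b)"
      using car by (auto dest!: elements_matD)
    then show "x \<in> minors q A"
      unfolding minors_def using entry[OF ab(1,2)] L[OF ab(1)] L[OF ab(2)] carrier_matD[OF A] by auto
  next
    fix x assume "x \<in> minors q A"
    then obtain I J where IJ: "x = ?m I J" "I \<in> set ` set ?L" "J \<in> set ` set ?L"
      unfolding minors_def set_lex_lists_image carrier_matD[OF A] by auto
    then obtain a b where ab: "a < length ?L" "I = set (?L ! a)" "b < length ?L" "J = set (?L ! b)"
      by (auto simp: in_set_conv_nth)
    then show "x \<in> elements_mat (exterior_power q A)"
      using elements_matI[OF car ab(1,3)] entry[OF ab(1,3)] IJ(1) by simp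
  qed
qed

lemma minors_nonempty:
  assumes "A \<in> carrier_mat m m" "q \<le> m"
  shows "minors q A \<noteq> {}"
proof -
  have "card {..<q} = q" "{..<q} \<subseteq> {..<dim_row A}" using assms by auto
  then show ?thesis unfolding minors_def by blast
qed

definition enorm :: "nat \<Rightarrow> real mat \<Rightarrow> real" where
  "enorm q A = max_norm (exterior_power q A)"

lemma finite_minors: "A \<in> carrier_mat m m \<Longrightarrow> finite (minors q A)"
  using elements_exterior_power[of A m q] by (metis List.finite_set elements_mat_def)

text \<open>Increasing enumerations of subsets are special index functions. Together with
  \<open>abs_fdet_le_enorm\<close> this makes the norm a maximum over arbitrary index functions, the
  form that fits the multilinear expansion. The bound \<open>q \<le> m\<close> makes the set of
  minors nonempty.\<close>

lemma enorm_le: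
  assumes A: "A \<in> carrier_mat m m" and q: "q \<le> m"
    and B: "\<And>f g. f \<in> {0..<q} \<rightarrow> {..<m} \<Longrightarrow> g \<in> {0..<q} \<rightarrow> {..<m} \<Longrightarrow>
      \<bar>fdet q (\<lambda>a b. A $$ (f a, g b))\<bar> \<le> B"
  shows "enorm q A \<le> B"
proof -
  have "\<bar>x\<bar> \<le> B" if "x \<in> minors q A" for x
  proof -
    obtain I J where IJ: "I \<subseteq> {..<m}" "J \<subseteq> {..<m}" "card I = q" "card J = q"
      "x = fdet q (\<lambda>a b. A $$ (pick I a, pick J b))"
      using \<open>x \<in> minors q A\<close> A unfolding minors_def by auto
    have "pick I \<in> {0..<q} \<rightarrow> {..<m}" "pick J \<in> {0..<q} \<rightarrow> {..<m}"
      using IJ(3,4) subsetD[OF IJ(1) pick_in_set] subsetD[OF IJ(2) pick_in_set] by auto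
    then show ?thesis unfolding IJ(5) by (rule B)
  qed
  then show ?thesis
    unfolding enorm_def max_norm_def elements_exterior_power[OF A]
    using minors_nonempty[OF A q] finite_minors[OF A] by simp
qed

text \<open>Injective index functions give a minor up to sign; a repeated value gives two equal rows
  or columns, hence determinant zero.\<close>

lemma abs_fdet_le_enorm:
  assumes A: "A \<in> carrier_mat m m" and q: "q \<le> m"
    and f: "f \<in> {0..<q} \<rightarrow> {..<m}" and g: "g \<in> {0..<q} \<rightarrow> {..<m}"
  shows "\<bar>fdet q (\<lambda>a b. A $$ (f a, g b))\<bar> \<le> enorm q A"
proof -
  have le: "\<bar>x\<bar> \<le> enorm q A" if "x \<in> minors q A" for x
    unfolding enorm_def max_norm_def elements_exterior_power[OF A]
    using that finite_minors[OF A] by simp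
  \<comment> \<open>Settles the cases where the determinant vanishes.\<close>
  have E: "0 \<le> enorm q A" using minors_nonempty[OF A q] le order_trans[OF abs_ge_zero] by blast
  consider "inj_on f {..<q}" "inj_on g {..<q}" | "\<not> inj_on f {..<q}" | "\<not> inj_on g {..<q}" by blast
  then show ?thesis
  proof cases
    case 1
    let ?I = "f ` {..<q}" and ?J = "g ` {..<q}"
    have "\<bar>fdet q (\<lambda>a b. A $$ (f a, g b))\<bar> = \<bar>fdet q (\<lambda>a b. A $$ (pick ?I a, g b))\<bar>"
      using abs_fdet_pick[OF 1(1), of "\<lambda>i b. A $$ (i, g b)"] .
    \<comment> \<open>Transposing turns the columns into rows, so that they can be sorted in the
      same way.\<close>
    also have "\<dots> = \<bar>fdet q (\<lambda>b a. A $$ (pick ?I a, g b))\<bar>"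
      using fdet_transpose[of q "\<lambda>a b. A $$ (pick ?I a, g b)"] by simp
    also have "\<dots> = \<bar>fdet q (\<lambda>b a. A $$ (pick ?I a, pick ?J b))\<bar>"
      using abs_fdet_pick[OF 1(2), of "\<lambda>j a. A $$ (pick ?I a, j)"] .
    also have "\<dots> = \<bar>fdet q (\<lambda>a b. A $$ (pick ?I a, pick ?J b))\<bar>"
      using fdet_transpose[of q "\<lambda>a b. A $$ (pick ?I a, pick ?J b)"] by simp
    also have "\<dots> \<le> enorm q A"
    proof (rule le)
      have "card ?I = q" "card ?J = q" using 1 by (simp_all add: card_image)
      moreover have "?I \<subseteq> {..<dim_row A}" "?J \<subseteq> {..<dim_row A}" using f g A by auto
      ultimately show "fdet q (\<lambda>a b. A $$ (pick ?I a, pick ?J b)) \<in> minors q A"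
        unfolding minors_def by blast
    qed
    finally show ?thesis .
  next
    case 2
    then obtain a b where "a < q" "b < q" "a \<noteq> b" "f a = f b" by (auto simp: inj_on_def)
    then have "fdet q (\<lambda>a b. A $$ (f a, g b)) = 0" by (intro fdet_eq_0[of a q b]) auto
    then show ?thesis using E by simp
  next
    case 3
    then obtain a b where "a < q" "b < q" "a \<noteq> b" "g a = g b" by (auto simp: inj_on_def)
    then have "fdet q (\<lambda>b a. A $$ (f a, g b)) = 0" by (intro fdet_eq_0[of a q b]) auto
    then have "fdet q (\<lambda>a b. A $$ (f a, g b)) = 0"
      using fdet_transpose[of q "\<lambda>a b. A $$ (f a, g b)"] by simp
    then show ?thesis using E by simp
  qed
qed

text \<open>The rows of \<open>A * B\<close> are combinations of rows of \<open>B\<close> with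
  entries of \<open>A\<close> as coefficients.\<close>

lemma enorm_mult_left_le:
  assumes A: "A \<in> carrier_mat m m" and B: "B \<in> carrier_mat m m" and q: "q \<le> m"
    and r: "\<And>i j. i < m \<Longrightarrow> j < m \<Longrightarrow> \<bar>A $$ (i, j)\<bar> \<le> r"
  shows "enorm q (A * B) \<le> (real m * r) ^ q * enorm q B"
proof (rule enorm_le[OF _ q])
  fix f g assume f: "f \<in> {0..<q} \<rightarrow> {..<m}" and g: "g \<in> {0..<q} \<rightarrow> {..<m}"
  have "fdet q (\<lambda>a b. (A * B) $$ (f a, g b)) = fdet q (\<lambda>a b. \<Sum>k<m. A $$ (f a, k) * B $$ (k, g b))"
  proof (rule fdet_cong)
    fix a b assume "a < q" "b < q"
    then have "f a < m" "g b < m" using f g by auto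
    then show "(A * B) $$ (f a, g b) = (\<Sum>k<m. A $$ (f a, k) * B $$ (k, g b))"
      using A B by (simp add: scalar_prod_def atLeast0LessThan)
  qed
  also have "\<bar>\<dots>\<bar> \<le> (real m * r) ^ q * enorm q B"
  proof (rule abs_fdet_sum_le[where M = "\<lambda>k b. B $$ (k, g b)"])
    show "\<bar>A $$ (f a, k)\<bar> \<le> r" if "a < q" "k < m" for a k using that f by (intro r) auto
    show "\<bar>fdet q (\<lambda>a b. B $$ (h a, g b))\<bar> \<le> enorm q B" if "h \<in> {0..<q} \<rightarrow> {..<m}" for h
      using abs_fdet_le_enorm[OF B q that g] .
  qed
  finally show "\<bar>fdet q (\<lambda>a b. (A * B) $$ (f a, g b))\<bar> \<le> (real m * r) ^ q * enorm q B" .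
qed (use A B in auto)

text \<open>The same expansion for the columns of \<open>A * B\<close>, carried out on the
  transposed determinant; now the entries of \<open>B\<close> are the coefficients.\<close>

lemma enorm_mult_right_le:
  assumes A: "A \<in> carrier_mat m m" and B: "B \<in> carrier_mat m m" and q: "q \<le> m"
    and r: "\<And>i j. i < m \<Longrightarrow> j < m \<Longrightarrow> \<bar>B $$ (i, j)\<bar> \<le> r"
  shows "enorm q (A * B) \<le> (real m * r) ^ q * enorm q A"
proof (rule enorm_le[OF _ q])
  fix f g assume f: "f \<in> {0..<q} \<rightarrow> {..<m}" and g: "g \<in> {0..<q} \<rightarrow> {..<m}"
  have "fdet q (\<lambda>a b. (A * B) $$ (f a, g b)) = fdet q (\<lambda>b a. (A * B) $$ (f a, g b))"
    using fdet_transpose[of q "\<lambda>a b. (A * B) $$ (f a, g b)"] by simp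
  also have "\<dots> = fdet q (\<lambda>b a. \<Sum>k<m. B $$ (k, g b) * A $$ (f a, k))"
  proof (rule fdet_cong)
    fix b a assume "b < q" "a < q"
    then have "f a < m" "g b < m" using f g by auto
    then show "(A * B) $$ (f a, g b) = (\<Sum>k<m. B $$ (k, g b) * A $$ (f a, k))"
      using A B by (simp add: scalar_prod_def atLeast0LessThan mult.commute)
  qed
  also have "\<bar>\<dots>\<bar> \<le> (real m * r) ^ q * enorm q A"
  proof (rule abs_fdet_sum_le[where M = "\<lambda>k a. A $$ (f a, k)"])
    show "\<bar>B $$ (k, g b)\<bar> \<le> r" if "b < q" "k < m" for b k using that g by (intro r) auto
    show "\<bar>fdet q (\<lambda>b a. A $$ (f a, h b))\<bar> \<le> enorm q A" if "h \<in> {0..<q} \<rightarrow> {..<m}" for h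
      using abs_fdet_le_enorm[OF A q f that] fdet_transpose[of q "\<lambda>a b. A $$ (f a, h b)"] by simp
  qed
  finally show "\<bar>fdet q (\<lambda>a b. (A * B) $$ (f a, g b))\<bar> \<le> (real m * r) ^ q * enorm q A" .
qed (use A B in auto)

text \<open>The leading principal minor of size \<open>q\<close> is a product of nonzero diagonal
  entries.\<close>

lemma enorm_pos:
  assumes A: "A \<in> carrier_mat m m" "upper_triangular A" and q: "q \<le> m"
    and nz: "\<And>i. i < m \<Longrightarrow> A $$ (i, i) \<noteq> 0"
  shows "0 < enorm q A"
proof -
  let ?D = "mat q q (\<lambda>(a, b). A $$ (a, b))"
  have "upper_triangular ?D" using A q by (intro upper_triangularI) auto
  then have "fdet q (\<lambda>a b. A $$ (a, b)) = prod_list (diag_mat ?D)"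
    unfolding fdet_def by (simp add: det_upper_triangular[of _ q])
  moreover have "prod_list (diag_mat ?D) \<noteq> 0"
    using nz q by (auto simp: prod_list_zero_iff diag_mat_def)
  ultimately have "0 < \<bar>fdet q (\<lambda>a b. A $$ (a, b))\<bar>" by simp
  also have "\<dots> \<le> enorm q A" using abs_fdet_le_enorm[OF A(1) q, of "\<lambda>a. a" "\<lambda>b. b"] q by auto
  finally show ?thesis .
qed

lemma abs_entry_le_enorm_1:
  assumes A: "A \<in> carrier_mat m m" and ij: "i < m" "j < m"
  shows "\<bar>A $$ (i, j)\<bar> \<le> enorm 1 A"
proof -
  have "fdet 1 (\<lambda>a b. A $$ (i, j)) = A $$ (i, j)"
    unfolding fdet_leibniz by simp
  then show ?thesis using abs_fdet_le_enorm[OF A, of 1 "\<lambda>_. i" "\<lambda>_. j"] ij by simp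
qed

lemma enorm_1_dim_1:
  assumes A: "A \<in> carrier_mat 1 1"
  shows "enorm 1 A = \<bar>A $$ (0, 0)\<bar>"
proof (rule antisym)
  show "enorm 1 A \<le> \<bar>A $$ (0, 0)\<bar>"
  proof (rule enorm_le[OF A])
    fix f g :: "nat \<Rightarrow> nat" assume "f \<in> {0..<1} \<rightarrow> {..<1}" "g \<in> {0..<1} \<rightarrow> {..<1}"
    then have "f 0 = 0" "g 0 = 0" by auto
    then show "\<bar>fdet 1 (\<lambda>a b. A $$ (f a, g b))\<bar> \<le> \<bar>A $$ (0, 0)\<bar>"
      unfolding fdet_leibniz by simp
  qed simp
  show "\<bar>A $$ (0, 0)\<bar> \<le> enorm 1 A" using abs_entry_le_enorm_1[OF A, of 0 0] by simp
qed

section \<open>Blocks\<close>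

text \<open>Exactly \<open>a\<close> elements of the interval lie below \<open>i + a\<close>, and
  \<open>pick\<close> inverts this count.\<close>

lemma pick_atLeastLessThan:
  assumes "a < j - i"
  shows "pick {i..<j} a = i + a"
proof -
  have "{x \<in> {i..<j}. x < i + a} = {i..<i + a}" using assms by auto
  then have "card {x \<in> {i..<j}. x < i + a} = a" by simp
  then show ?thesis using pick_card_in_set[of "i + a" "{i..<j}"] assms by simp
qed

lemma block_eq:
  assumes X: "X \<in> carrier_mat n n" and ij: "1 \<le> i" "i \<le> j" "j \<le> n"
  shows "block i j X = mat (j - i + 1) (j - i + 1) (\<lambda>(a, b). X $$ (i - 1 + a, i - 1 + b))"
proof -
  have "{k. k < n \<and> k \<in> {i - 1..<j}} = {i - 1..<j}" using ij by auto
  \<comment> \<open>The zero-based interval starts at \<open>i - 1\<close>, so its size is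
    \<open>j - (i - 1)\<close>.\<close>
  then have card: "card {k. k < n \<and> k \<in> {i - 1..<j}} = j - i + 1" using ij by simp
  have "pick {i - 1..<j} a = i - 1 + a" if "a < j - i + 1" for a
    using pick_atLeastLessThan[of a j "i - 1"] that ij by simp
  then show ?thesis
    using X unfolding block_def submatrix_def carrier_matD[OF X] card by (intro eq_matI) auto
qed

text \<open>In an entry of the product only summation indices inside the block contribute: for
  earlier ones the factor from \<open>X\<close> lies below the diagonal, for later ones the factor
  from \<open>Y\<close> does.\<close>

lemma block_mult:
  assumes X: "X \<in> carrier_mat n n" "upper_triangular X" and Y: "Y \<in> carrier_mat n n" "upper_triangular Y"
    and ij: "1 \<le> i" "i \<le> j" "j \<le> n"
  shows "block i j (X * Y) = block i j X * block i j Y"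
proof -
  let ?m = "j - i + 1" and ?i = "i - 1"
  have XY: "X * Y \<in> carrier_mat n n" using X Y by simp
  have *: "(\<Sum>k = 0..<n. X $$ (?i + a, k) * Y $$ (k, ?i + b)) =
      (\<Sum>k = 0..<?m. X $$ (?i + a, ?i + k) * Y $$ (?i + k, ?i + b))" if ab: "a < ?m" "b < ?m" for a b
  proof -
    have "(\<Sum>k = 0..<n. X $$ (?i + a, k) * Y $$ (k, ?i + b)) =
        (\<Sum>k = ?i..<?i + ?m. X $$ (?i + a, k) * Y $$ (k, ?i + b))"
    proof (rule sum.mono_neutral_right)
      show "\<forall>k\<in>{0..<n} - {?i..<?i + ?m}. X $$ (?i + a, k) * Y $$ (k, ?i + b) = 0"
      proof
        fix k assume k: "k \<in> {0..<n} - {?i..<?i + ?m}"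
        then consider "k < ?i + a" | "?i + b < k" using ab by fastforce
        then show "X $$ (?i + a, k) * Y $$ (k, ?i + b) = 0"
          by cases (use X Y k ab ij in \<open>auto simp: upper_triangularD\<close>)
      qed
    qed (use ij in auto)
    also have "\<dots> = (\<Sum>k = 0..<?m. X $$ (?i + a, ?i + k) * Y $$ (?i + k, ?i + b))"
      using sum.shift_bounds_nat_ivl[of "\<lambda>k. X $$ (?i + a, k) * Y $$ (k, ?i + b)" 0 ?i ?m]
      by (simp add: add.commute)
    finally show ?thesis .
  qed
  show ?thesis
    unfolding block_eq[OF X(1) ij] block_eq[OF Y(1) ij] block_eq[OF XY ij]
  proof (rule eq_matI)
    fix a b
    assume "a < dim_row (mat ?m ?m (\<lambda>(a, b). X $$ (?i + a, ?i + b)) * mat ?m ?m (\<lambda>(a, b). Y $$ (?i + a, ?i + b)))"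
      "b < dim_col (mat ?m ?m (\<lambda>(a, b). X $$ (?i + a, ?i + b)) * mat ?m ?m (\<lambda>(a, b). Y $$ (?i + a, ?i + b)))"
    then have ab: "a < ?m" "b < ?m" by auto
    then have "?i + a < n" "?i + b < n" using ij by auto
    then show "mat ?m ?m (\<lambda>(a, b). (X * Y) $$ (?i + a, ?i + b)) $$ (a, b) =
        (mat ?m ?m (\<lambda>(a, b). X $$ (?i + a, ?i + b)) * mat ?m ?m (\<lambda>(a, b). Y $$ (?i + a, ?i + b))) $$ (a, b)"
      using X Y ab *[OF ab] by (simp add: scalar_prod_def)
  qed auto
qed

section \<open>The group of upper triangular matrices\<close>

text \<open>\<open>inverts_mat\<close> leaves the shape of \<open>B\<close> open; comparing the
  column counts of both products with those of identity matrices determines it.\<close>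

lemma carrier_mat_inverses:
  assumes X: "X \<in> carrier_mat n n" and B: "inverts_mat X B" "inverts_mat B X"
  shows "B \<in> carrier_mat n n"
proof -
  have "X * B = 1\<^sub>m n" "B * X = 1\<^sub>m (dim_row B)" using X B by (auto simp: inverts_mat_def)
  then have "dim_col (X * B) = n" "dim_col (B * X) = dim_row B" by simp_all
  then show ?thesis using X by (intro carrier_matI) auto
qed

text \<open>Cramer's formula. It writes the entries of the inverse as quotients of determinants,
  from which continuity of inversion is read off.\<close>

definition minv :: "'a::field mat \<Rightarrow> 'a mat" where
  "minv X = (1 / Determinant.det X) \<cdot>\<^sub>m adj_mat X"

lemma minv:
  fixes X :: "'a::field mat"
  assumes X: "X \<in> carrier_mat n n" and det: "Determinant.det X \<noteq> 0"
  shows "minv X \<in> carrier_mat n n" "X * minv X = 1\<^sub>m n" "minv X * X = 1\<^sub>m n"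
proof -
  note adj = adj_mat[OF X]
  show "minv X \<in> carrier_mat n n" using adj(1) by (simp add: minv_def)
  have "X * minv X = (1 / Determinant.det X) \<cdot>\<^sub>m (X * adj_mat X)"
    unfolding minv_def by (rule mult_smult_distrib[OF X adj(1)])
  also have "\<dots> = 1\<^sub>m n" unfolding adj(2) using det by (intro eq_matI) auto
  finally show "X * minv X = 1\<^sub>m n" .
  have "minv X * X = (1 / Determinant.det X) \<cdot>\<^sub>m (adj_mat X * X)"
    unfolding minv_def by (rule mult_smult_assoc_mat[OF adj(1) X])
  also have "\<dots> = 1\<^sub>m n" unfolding adj(3) using det by (intro eq_matI) auto
  finally show "minv X * X = 1\<^sub>m n" .
qed

lemma invertible_mat_iff_det:
  fixes X :: "'a::field mat"
  assumes X: "X \<in> carrier_mat n n"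
  shows "invertible_mat X \<longleftrightarrow> Determinant.det X \<noteq> 0"
proof
  assume "invertible_mat X"
  then obtain B where B: "inverts_mat X B" "inverts_mat B X" by (auto simp: invertible_mat_def)
  then have "X * B = 1\<^sub>m n" using X by (simp add: inverts_mat_def)
  then have "Determinant.det X * Determinant.det B = 1"
    using Determinant.det_mult[OF X carrier_mat_inverses[OF X B]] by simp
  then show "Determinant.det X \<noteq> 0" by auto
next
  assume "Determinant.det X \<noteq> 0"
  note inv = minv[OF X this]
  have "inverts_mat X (minv X)" "inverts_mat (minv X) X"
    using inv carrier_matD[OF X] carrier_matD[OF inv(1)] by (simp_all add: inverts_mat_def)
  then show "invertible_mat X" using X by (auto simp: invertible_mat_def)
qed

lemma UT_simps [simp]: "X \<otimes>\<^bsub>UT n\<^esub> Y = X * Y" "\<one>\<^bsub>UT n\<^esub> = 1\<^sub>m n"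
  by (simp_all add: UT_def)

lemma carrier_UT_det:
  "X \<in> carrier (UT n) \<longleftrightarrow> X \<in> carrier_mat n n \<and> upper_triangular X \<and> Determinant.det X \<noteq> 0"
  using invertible_mat_iff_det[of X n] by (auto simp: UT_def)

text \<open>The determinant of a triangular matrix is the product of its diagonal. Bounding diagonal
  entries away from zero therefore keeps a matrix in the group.\<close>

lemma carrier_UT_diag:
  "X \<in> carrier (UT n) \<longleftrightarrow>
     X \<in> carrier_mat n n \<and> upper_triangular X \<and> (\<forall>i<n. X $$ (i, i) \<noteq> 0)"
  unfolding carrier_UT_det using upper_triangular_imp_det_eq_0_iff[of X n]
  by (auto simp: diag_mat_def)

lemma upper_triangular_mult:
  fixes X Y :: "'a::comm_ring_1 mat"
  assumes X: "X \<in> carrier_mat n n" "upper_triangular X" and Y: "Y \<in> carrier_mat n n" "upper_triangular Y"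
  shows "upper_triangular (X * Y)"
proof (rule upper_triangularI)
  fix i j assume ij: "j < i" "i < dim_row (X * Y)"
  have "X $$ (i, k) * Y $$ (k, j) = 0" if "k < n" for k
    using X Y ij that by (cases "k < i") (auto simp: upper_triangularD)
  then show "(X * Y) $$ (i, j) = 0"
    using X Y ij by (auto simp: scalar_prod_def intro!: sum.neutral)
qed

text \<open>Induction on the column \<open>j\<close>: in entry \<open>(i, j)\<close> of
  \<open>Y * X\<close> the terms with \<open>k < j\<close> vanish by induction and those with
  \<open>k > j\<close> by triangularity of \<open>X\<close>. What remains is
  \<open>Y $$ (i, j)\<close> times a nonzero diagonal entry.\<close>

lemma upper_triangular_inverse:
  fixes X Y :: "'a::field mat"
  assumes X: "X \<in> carrier_mat n n" "upper_triangular X" and nz: "\<And>i. i < n \<Longrightarrow> X $$ (i, i) \<noteq> 0"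
    and Y: "Y \<in> carrier_mat n n" "Y * X = 1\<^sub>m n"
  shows "upper_triangular Y"
proof -
  have "Y $$ (i, j) = 0" if "j < i" "i < n" for i j
    using that
  proof (induction j rule: less_induct)
    case (less j)
    have "0 = (Y * X) $$ (i, j)" using less.prems unfolding Y(2) by simp
    also have "\<dots> = (\<Sum>k = 0..<n. Y $$ (i, k) * X $$ (k, j))"
      using less.prems X(1) Y(1) by (simp add: scalar_prod_def)
    also have "\<dots> = (\<Sum>k\<in>{j}. Y $$ (i, k) * X $$ (k, j))"
    proof (rule sum.mono_neutral_right)
      show "\<forall>k\<in>{0..<n} - {j}. Y $$ (i, k) * X $$ (k, j) = 0"
      proof
        fix k assume k: "k \<in> {0..<n} - {j}"
        show "Y $$ (i, k) * X $$ (k, j) = 0"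
        proof (cases "k < j")
          case True
          then show ?thesis using less.IH[of k] less.prems by simp
        next
          case False
          then show ?thesis using k X by (auto simp: upper_triangularD)
        qed
      qed
    qed (use less.prems in auto)
    finally show ?case using nz[of j] less.prems by simp
  qed
  then show ?thesis using Y(1) by (intro upper_triangularI) auto
qed

lemma minv_carrier_UT:
  assumes "X \<in> carrier (UT n)"
  shows "minv X \<in> carrier (UT n)"
proof -
  have X: "X \<in> carrier_mat n n" "upper_triangular X" "Determinant.det X \<noteq> 0"
    using assms by (auto simp: carrier_UT_det)
  note inv = minv[OF X(1,3)]
  have "Determinant.det (minv X) * Determinant.det X = 1"
    using Determinant.det_mult[OF inv(1) X(1)] inv(3) by simp
  then have "Determinant.det (minv X) \<noteq> 0" by auto
  moreover have "upper_triangular (minv X)"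
    using assms by (intro upper_triangular_inverse[OF X(1,2) _ inv(1,3)]) (simp add: carrier_UT_diag)
  ultimately show ?thesis using inv(1) by (simp add: carrier_UT_det)
qed

lemma group_UT: "group (UT n)"
proof (rule groupI)
  fix X Y Z assume X: "X \<in> carrier (UT n)" and Y: "Y \<in> carrier (UT n)"
  then have XY: "X \<in> carrier_mat n n" "Y \<in> carrier_mat n n" by (auto simp: carrier_UT_det)
  then show "X \<otimes>\<^bsub>UT n\<^esub> Y \<in> carrier (UT n)"
    using X Y Determinant.det_mult[OF XY] by (simp add: carrier_UT_det upper_triangular_mult)
  assume "Z \<in> carrier (UT n)"
  then have "Z \<in> carrier_mat n n" by (simp add: carrier_UT_det)
  with XY show "X \<otimes>\<^bsub>UT n\<^esub> Y \<otimes>\<^bsub>UT n\<^esub> Z = X \<otimes>\<^bsub>UT n\<^esub> (Y \<otimes>\<^bsub>UT n\<^esub> Z)" by simp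
next
  show "\<one>\<^bsub>UT n\<^esub> \<in> carrier (UT n)" by (simp add: carrier_UT_det)
next
  fix X assume X: "X \<in> carrier (UT n)"
  then have X': "X \<in> carrier_mat n n" "Determinant.det X \<noteq> 0" by (auto simp: carrier_UT_det)
  then show "\<one>\<^bsub>UT n\<^esub> \<otimes>\<^bsub>UT n\<^esub> X = X" by simp
  show "\<exists>Y\<in>carrier (UT n). Y \<otimes>\<^bsub>UT n\<^esub> X = \<one>\<^bsub>UT n\<^esub>"
    using minv_carrier_UT[OF X] minv(3)[OF X'] by auto
qed

lemma m_inv_UT:
  assumes X: "X \<in> carrier (UT n)"
  shows "inv\<^bsub>UT n\<^esub> X = minv X"
  using minv_carrier_UT[OF X] minv(3)[of X n] X
  by (intro group.inv_equality[OF group_UT]) (auto simp: carrier_UT_det)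

section \<open>The topology on \<open>UT n\<close>: continuity, compact sets and local
  compactness\<close>

lemma topspace_UT_top: "topspace (UT_top n) = carrier (UT n)"
  by (auto simp: UT_top_def topspace_pullback_topology)

lemma continuous_map_entry:
  assumes "i < n" "j < n"
  shows "continuous_map (UT_top n) euclideanreal (\<lambda>X. X $$ (i, j))"
proof -
  have "continuous_map (product_topology (\<lambda>_. euclideanreal) ({..<n} \<times> {..<n})) euclideanreal (\<lambda>g. g (i, j))"
    using assms by (intro continuous_map_product_projection) auto
  then have "continuous_map (UT_top n) euclideanreal
      ((\<lambda>g. g (i, j)) \<circ> (\<lambda>X. \<lambda>p \<in> {..<n} \<times> {..<n}. X $$ p))"
    unfolding UT_top_def by (rule continuous_map_pullback)
  then show ?thesis
    by (rule continuous_map_eq) (use assms in auto)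
qed

text \<open>The universal property of the pullback topology reduces continuity to single
  entries.\<close>

lemma continuous_map_into_UT_top:
  assumes f: "f \<in> topspace Z \<rightarrow> carrier (UT n)"
    and entry: "\<And>i j. i < n \<Longrightarrow> j < n \<Longrightarrow> continuous_map Z euclideanreal (\<lambda>z. f z $$ (i, j))"
  shows "continuous_map Z (UT_top n) f"
  unfolding UT_top_def
proof (rule continuous_map_pullback')
  show "topspace Z \<subseteq> f -` carrier (UT n)" using f by auto
  show "continuous_map Z (product_topology (\<lambda>_. euclideanreal) ({..<n} \<times> {..<n}))
      ((\<lambda>X. \<lambda>p \<in> {..<n} \<times> {..<n}. X $$ p) \<circ> f)"
    unfolding continuous_map_componentwise using entry by auto
qed

lemma continuous_map_fdet:
  assumes "\<And>a b. a < q \<Longrightarrow> b < q \<Longrightarrow> continuous_map Z euclideanreal (\<lambda>z. M z a b)"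
  shows "continuous_map Z euclideanreal (\<lambda>z. fdet q (M z))"
  unfolding fdet_leibniz
proof (intro continuous_map_sum continuous_map_real_mult_left continuous_map_prod)
  fix p i assume "p \<in> {p. p permutes {0..<q}}" "i \<in> {0..<q}"
  then show "continuous_map Z euclideanreal (\<lambda>z. M z i (p i))"
    using permutes_in_image[of p "{0..<q}" i] by (intro assms) auto
qed (auto simp: finite_permutations)

lemma det_eq_fdet:
  assumes "X \<in> carrier_mat q q"
  shows "Determinant.det X = fdet q (\<lambda>a b. X $$ (a, b))"
proof -
  have "X = mat q q (\<lambda>(a, b). X $$ (a, b))" using assms by (intro eq_matI) auto
  then show ?thesis by (simp add: fdet_def)
qed

text \<open>Products have polynomial entries, and inverses have cofactors divided by the
  nonvanishing determinant.\<close>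

lemma topological_group_UT: "topological_group (UT n) (UT_top n)"
proof (intro topological_group.intro group_UT topological_group_axioms.intro topspace_UT_top)
  interpret group "UT n" by (rule group_UT)
  show "continuous_map (prod_topology (UT_top n) (UT_top n)) (UT_top n) (\<lambda>(X, Y). X \<otimes>\<^bsub>UT n\<^esub> Y)"
  proof (rule continuous_map_into_UT_top)
    show "(\<lambda>(X, Y). X \<otimes>\<^bsub>UT n\<^esub> Y) \<in> topspace (prod_topology (UT_top n) (UT_top n)) \<rightarrow> carrier (UT n)"
      unfolding topspace_prod_topology topspace_UT_top by (auto simp del: UT_simps)
    fix i j assume ij: "i < n" "j < n"
    have "continuous_map (prod_topology (UT_top n) (UT_top n)) euclideanreal
        (\<lambda>P. \<Sum>k = 0..<n. fst P $$ (i, k) * snd P $$ (k, j))"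
    proof (intro continuous_map_sum continuous_map_real_mult)
      fix k assume k: "k \<in> {0..<n}"
      show "continuous_map (prod_topology (UT_top n) (UT_top n)) euclideanreal (\<lambda>P. fst P $$ (i, k))"
        using continuous_map_compose[OF continuous_map_fst continuous_map_entry[of i n k]] ij k
        by (simp add: o_def)
      show "continuous_map (prod_topology (UT_top n) (UT_top n)) euclideanreal (\<lambda>P. snd P $$ (k, j))"
        using continuous_map_compose[OF continuous_map_snd continuous_map_entry[of k n j]] ij k
        by (simp add: o_def)
    qed simp
    then show "continuous_map (prod_topology (UT_top n) (UT_top n)) euclideanreal
        (\<lambda>P. (case P of (X, Y) \<Rightarrow> X \<otimes>\<^bsub>UT n\<^esub> Y) $$ (i, j))"
    proof (rule continuous_map_eq)
      fix P assume "P \<in> topspace (prod_topology (UT_top n) (UT_top n))"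
      then have "fst P \<in> carrier_mat n n" "snd P \<in> carrier_mat n n"
        by (auto simp: topspace_UT_top carrier_UT_det)
      then show "(\<Sum>k = 0..<n. fst P $$ (i, k) * snd P $$ (k, j)) =
          (case P of (X, Y) \<Rightarrow> X \<otimes>\<^bsub>UT n\<^esub> Y) $$ (i, j)"
        using ij by (simp add: case_prod_unfold scalar_prod_def)
    qed
  qed
  show "continuous_map (UT_top n) (UT_top n) (\<lambda>X. inv\<^bsub>UT n\<^esub> X)"
  proof (rule continuous_map_into_UT_top)
    show "(\<lambda>X. inv\<^bsub>UT n\<^esub> X) \<in> topspace (UT_top n) \<rightarrow> carrier (UT n)"
      unfolding topspace_UT_top by auto
    fix i j assume ij: "i < n" "j < n"
    \<comment> \<open>The index shifts skip row \<open>j\<close> and column \<open>i\<close>. The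
      positions are exchanged because the adjugate is the transposed cofactor matrix.\<close>
    let ?M = "\<lambda>(X :: real mat) a b. X $$ (if a < j then a else Suc a, if b < i then b else Suc b)"
    have "continuous_map (UT_top n) euclideanreal
        (\<lambda>X. (- 1) ^ (j + i) * fdet (n - 1) (?M X) / fdet n (\<lambda>a b. X $$ (a, b)))"
    proof (intro continuous_map_real_divide continuous_map_real_mult_left continuous_map_fdet
        continuous_map_entry)
      fix X assume "X \<in> topspace (UT_top n)"
      then show "fdet n (\<lambda>a b. X $$ (a, b)) \<noteq> 0"
        using det_eq_fdet[of X n] by (simp add: topspace_UT_top carrier_UT_det)
    qed auto
    then show "continuous_map (UT_top n) euclideanreal (\<lambda>X. (inv\<^bsub>UT n\<^esub> X) $$ (i, j))"
    proof (rule continuous_map_eq)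
      fix X assume "X \<in> topspace (UT_top n)"
      then have XU: "X \<in> carrier (UT n)" by (simp add: topspace_UT_top)
      then have X: "X \<in> carrier_mat n n" by (simp add: carrier_UT_det)
      have "Determinant.det (mat_delete X j i) = fdet (n - 1) (?M X)"
        using X by (simp add: mat_delete_def fdet_def)
      then show "(- 1) ^ (j + i) * fdet (n - 1) (?M X) / fdet n (\<lambda>a b. X $$ (a, b)) =
          (inv\<^bsub>UT n\<^esub> X) $$ (i, j)"
        using X ij unfolding m_inv_UT[OF XU] det_eq_fdet[OF X, symmetric]
        by (simp add: minv_def adj_mat_def cofactor_def)
    qed
  qed
qed

text \<open>The set is a continuous image of a product of compact sets of admissible entries. The
  lower bound on the diagonal excludes singular limits. This box serves both for local compactness
  and for coarse properness.\<close>

lemma compactin_UT_box: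
  assumes R: "0 < R"
  shows "compactin (UT_top n)
    {X \<in> carrier (UT n). \<forall>i<n. (\<forall>j<n. \<bar>X $$ (i, j)\<bar> \<le> R) \<and> 1 / R \<le> \<bar>X $$ (i, i)\<bar>}"
    (is "compactin _ ?K")
proof -
  let ?P = "product_topology (\<lambda>_. euclideanreal) ({..<n} \<times> {..<n})"
  \<comment> \<open>Admissible values at position \<open>p\<close>: zero below the diagonal, two
    intervals avoiding zero on it, and one interval above it.\<close>
  define S where "S p = (if snd p < fst p then {0} else if fst p = snd p
    then {- R..- (1 / R)} \<union> {1 / R..R} else {- R..R})" for p :: "nat \<times> nat"
  define B where "B = PiE ({..<n} \<times> {..<n}) S"
  define h where "h \<phi> = mat n n \<phi>" for \<phi> :: "nat \<times> nat \<Rightarrow> real"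
  have S: "compact (S p)" for p by (auto simp: S_def intro!: compact_Un)
  have "compactin ?P B" unfolding B_def compactin_PiE using S by simp
  \<comment> \<open>The map \<open>h\<close> reaches the group only from \<open>B\<close>, so
    compactness is moved to the subspace \<open>B\<close>.\<close>
  then have cB: "compactin (subtopology ?P B) B" by (simp add: compactin_subtopology)
  have BS: "\<phi> (i, j) \<in> S (i, j)" if "\<phi> \<in> B" "i < n" "j < n" for \<phi> i j
    using that by (auto simp: B_def)
  have hB: "h \<phi> \<in> ?K" if \<phi>: "\<phi> \<in> B" for \<phi>
  proof -
    have up: "\<phi> (i, j) = 0" if "j < i" "i < n" for i j
      using BS[OF \<phi>, of i j] that by (simp add: S_def)
    have diag: "1 / R \<le> \<bar>\<phi> (i, i)\<bar>" if "i < n" for i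
      using BS[OF \<phi>, of i i] that R by (auto simp: S_def)
    then have nz: "\<phi> (i, i) \<noteq> 0" if "i < n" for i
      using R diag[OF that] divide_pos_pos[of 1 R] by auto
    \<comment> \<open>Naming \<open>1 / R\<close> leaves linear inequalities in \<open>s\<close> and
      \<open>R\<close>.\<close>
    define s where "s = 1 / R"
    have "0 < s" using R by (simp add: s_def)
    then have "S p \<subseteq> {- R..R}" for p
      using R by (auto simp: S_def s_def[symmetric])
    then have bd: "\<bar>\<phi> (i, j)\<bar> \<le> R" if "i < n" "j < n" for i j
      using BS[OF \<phi> that] by (force simp: abs_le_iff)
    show ?thesis
      using up diag nz bd by (auto simp: carrier_UT_diag h_def)
  qed
  have "continuous_map (subtopology ?P B) (UT_top n) h"
  proof (rule continuous_map_into_UT_top)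
    show "h \<in> topspace (subtopology ?P B) \<rightarrow> carrier (UT n)" using hB by auto
    fix i j assume ij: "i < n" "j < n"
    then have "continuous_map (subtopology ?P B) euclideanreal (\<lambda>\<phi>. \<phi> (i, j))"
      by (intro continuous_map_from_subtopology continuous_map_product_projection) auto
    then show "continuous_map (subtopology ?P B) euclideanreal (\<lambda>\<phi>. h \<phi> $$ (i, j))"
      using ij by (simp add: h_def)
  qed
  then have "compactin (UT_top n) (h ` B)" using cB image_compactin by blast
  moreover have "h ` B = ?K"
  proof (intro equalityI subsetI)
    fix X assume X: "X \<in> ?K"
    then have XU: "X \<in> carrier_mat n n" "upper_triangular X" by (auto simp: carrier_UT_diag)
    have bd: "\<bar>X $$ (i, j)\<bar> \<le> R" if "i < n" "j < n" for i j using X that by blast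
    have dg: "1 / R \<le> \<bar>X $$ (i, i)\<bar>" if "i < n" for i using X that by blast
    let ?\<phi> = "\<lambda>p \<in> {..<n} \<times> {..<n}. X $$ p"
    have "X $$ (i, j) \<in> S (i, j)" if "i < n" "j < n" for i j
      using bd[OF that] dg[OF that(1)] XU that by (auto simp: S_def upper_triangularD abs_real_def split: if_splits)
    then have "?\<phi> \<in> B" unfolding B_def by auto
    moreover have "X = h ?\<phi>" unfolding h_def using XU(1) by (intro eq_matI) auto
    ultimately show "X \<in> h ` B" by blast
  qed (use hB in blast)
  ultimately show ?thesis by simp
qed

text \<open>The entries embed the group injectively into a Hausdorff product. For local compactness,
  strict versions of the inequalities of a compact box give an open neighbourhood inside it.\<close>

lemma lch_group_UT: "lch_group (UT n) (UT_top n)"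
proof (intro lch_group.intro topological_group_UT lch_group_axioms.intro)
  let ?f = "\<lambda>X :: real mat. \<lambda>p \<in> {..<n} \<times> {..<n}. X $$ p"
  show "Hausdorff_space (UT_top n)"
  proof (rule Hausdorff_space_injective_preimage)
    show "Hausdorff_space (product_topology (\<lambda>_. euclideanreal) ({..<n} \<times> {..<n}))"
      by (simp add: Hausdorff_space_product_topology)
    show "continuous_map (UT_top n) (product_topology (\<lambda>_. euclideanreal) ({..<n} \<times> {..<n})) ?f"
      unfolding continuous_map_componentwise using continuous_map_entry by auto
    show "inj_on ?f (topspace (UT_top n))"
    proof (rule inj_onI)
      fix X Y assume "X \<in> topspace (UT_top n)" "Y \<in> topspace (UT_top n)" and eq: "?f X = ?f Y"
      then have XY: "X \<in> carrier_mat n n" "Y \<in> carrier_mat n n"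
        by (auto simp: topspace_UT_top carrier_UT_det)
      have "X $$ (i, j) = Y $$ (i, j)" if "i < n" "j < n" for i j
        using fun_cong[OF eq, of "(i, j)"] that by simp
      then show "X = Y" using XY by (intro eq_matI) auto
    qed
  qed
  show "locally_compact_space (UT_top n)"
    unfolding locally_compact_space_def
  proof
    fix X assume "X \<in> topspace (UT_top n)"
    then have X: "X \<in> carrier (UT n)" by (simp add: topspace_UT_top)
    \<comment> \<open>The summand \<open>1\<close> makes \<open>R\<close> strictly larger than every
      entry in absolute value and every reciprocal of a diagonal entry.\<close>
    define R where "R = 1 + (\<Sum>p\<in>{..<n} \<times> {..<n}. \<bar>X $$ p\<bar>) + (\<Sum>i<n. 1 / \<bar>X $$ (i, i)\<bar>)"
    let ?K = "{X \<in> carrier (UT n). \<forall>i<n. (\<forall>j<n. \<bar>X $$ (i, j)\<bar> \<le> R) \<and> 1 / R \<le> \<bar>X $$ (i, i)\<bar>}"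
    let ?V = "\<lambda>i j. {Y \<in> topspace (UT_top n). Y $$ (i, j) \<in> {- R<..<R}}"
    let ?W = "\<lambda>i. {Y \<in> topspace (UT_top n). Y $$ (i, i) \<in> - {- (1 / R)..1 / R}}"
    let ?T = "topspace (UT_top n)"
    \<comment> \<open>Intersecting with \<open>?T\<close> keeps \<open>U\<close> inside the space
      even when the index range is empty.\<close>
    define U where "U = (\<Inter>i\<in>{..<n}. ((\<Inter>j\<in>{..<n}. ?V i j) \<inter> ?T) \<inter> ?W i) \<inter> ?T"
    have s1: "\<bar>X $$ (i, j)\<bar> \<le> (\<Sum>p\<in>{..<n} \<times> {..<n}. \<bar>X $$ p\<bar>)" if "i < n" "j < n" for i j
      using member_le_sum[of "(i, j)" "{..<n} \<times> {..<n}" "\<lambda>p. \<bar>X $$ p\<bar>"] that by auto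
    have s2: "1 / \<bar>X $$ (i, i)\<bar> \<le> (\<Sum>i<n. 1 / \<bar>X $$ (i, i)\<bar>)" if "i < n" for i
      using member_le_sum[of i "{..<n}" "\<lambda>i. 1 / \<bar>X $$ (i, i)\<bar>"] that by auto
    have p1: "0 \<le> (\<Sum>p\<in>{..<n} \<times> {..<n}. \<bar>X $$ p\<bar>)" and p2: "0 \<le> (\<Sum>i<n. 1 / \<bar>X $$ (i, i)\<bar>)"
      by (auto intro!: sum_nonneg)
    have R: "0 < R" using p1 p2 unfolding R_def by linarith
    have opV: "openin (UT_top n) (?V i j)" if "i < n" "j < n" for i j
      by (rule openin_continuous_map_preimage[OF continuous_map_entry[OF that]]) simp
    have opW: "openin (UT_top n) (?W i)" if "i < n" for i
      by (rule openin_continuous_map_preimage[OF continuous_map_entry[OF that that]])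
        (simp add: open_Compl)
    have opU: "openin (UT_top n) U"
      unfolding U_def by (intro openin_INT openin_Int opV opW) auto
    have "X \<in> U"
    proof -
      have "\<bar>X $$ (i, j)\<bar> < R" if "i < n" "j < n" for i j
        using s1[OF that] p2 unfolding R_def by linarith
      moreover have "1 / R < \<bar>X $$ (i, i)\<bar>" if "i < n" for i
      proof -
        have nz: "0 < \<bar>X $$ (i, i)\<bar>" using X that by (simp add: carrier_UT_diag)
        have "1 / \<bar>X $$ (i, i)\<bar> < R" using s2[OF that] p1 unfolding R_def by linarith
        then show ?thesis using nz R by (simp add: field_simps)
      qed
      ultimately show ?thesis
        using X by (force simp: U_def topspace_UT_top abs_real_def split: if_splits)
    qed
    moreover have "U \<subseteq> ?K"
    proof
      fix Y assume Y: "Y \<in> U"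
      have "\<bar>Y $$ (i, j)\<bar> \<le> R" if "i < n" "j < n" for i j
      proof -
        have "Y \<in> ?V i j" using Y that unfolding U_def by blast
        then show ?thesis by auto
      qed
      moreover have "1 / R \<le> \<bar>Y $$ (i, i)\<bar>" if "i < n" for i
      proof -
        have "Y \<in> ?W i" using Y that unfolding U_def by blast
        then have "\<not> (- (1 / R) \<le> Y $$ (i, i) \<and> Y $$ (i, i) \<le> 1 / R)" by simp
        then show ?thesis by linarith
      qed
      ultimately show "Y \<in> ?K" using Y by (auto simp: U_def topspace_UT_top)
    qed
    ultimately show "\<exists>U K. openin (UT_top n) U \<and> compactin (UT_top n) K \<and> X \<in> U \<and> U \<subseteq> K"
      using opU compactin_UT_box[OF R] by blast
  qed
qed

section \<open>The map is coarse\<close>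

text \<open>Each entry is a continuous function, hence bounded on \<open>C\<close>; the sum of the
  finitely many bounds in absolute value serves for all entries.\<close>

lemma compactin_UT_bounded:
  assumes C: "compactin (UT_top n) C"
  obtains r where "\<And>X i j. X \<in> C \<Longrightarrow> i < n \<Longrightarrow> j < n \<Longrightarrow> \<bar>X $$ (i, j)\<bar> \<le> r"
proof -
  let ?N = "{..<n} \<times> {..<n}"
  have "\<forall>p\<in>?N. \<exists>r. \<forall>X\<in>C. \<bar>X $$ p\<bar> \<le> r"
  proof
    fix p assume "p \<in> ?N"
    then have "continuous_map (UT_top n) euclideanreal (\<lambda>X. X $$ (fst p, snd p))"
      by (intro continuous_map_entry) auto
    from image_compactin[OF C this] have "bounded ((\<lambda>X. X $$ p) ` C)"
      by (simp add: compact_imp_bounded)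
    then show "\<exists>r. \<forall>X\<in>C. \<bar>X $$ p\<bar> \<le> r" by (auto simp: bounded_iff)
  qed
  then obtain r where r: "\<forall>p\<in>?N. \<forall>X\<in>C. \<bar>X $$ p\<bar> \<le> r p"
    unfolding bchoice_iff by blast
  have "\<bar>X $$ (i, j)\<bar> \<le> (\<Sum>p\<in>?N. \<bar>r p\<bar>)" if "X \<in> C" "i < n" "j < n" for X i j
  proof -
    have "\<bar>X $$ (i, j)\<bar> \<le> r (i, j)" using r that by blast
    also have "\<dots> \<le> \<bar>r (i, j)\<bar>" by simp
    also have "\<dots> \<le> (\<Sum>p\<in>?N. \<bar>r p\<bar>)"
      using that by (intro member_le_sum[of "(i, j)" ?N "\<lambda>p. \<bar>r p\<bar>"]) auto
    finally show ?thesis .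
  qed
  then show ?thesis by (rule that)
qed

text \<open>The diagonal of a block is part of the diagonal of \<open>X\<close>. Positivity allows
  the logarithms in \<open>mu\<close> to be compared and split.\<close>

lemma enorm_block_pos:
  assumes X: "X \<in> carrier (UT n)" and ij: "1 \<le> i" "i \<le> j" "j \<le> n" and q: "q \<le> j - i + 1"
  shows "0 < enorm q (block i j X)"
proof -
  have X': "X \<in> carrier_mat n n" "upper_triangular X" "\<And>i. i < n \<Longrightarrow> X $$ (i, i) \<noteq> 0"
    using X by (auto simp: carrier_UT_diag)
  show ?thesis
  proof (rule enorm_pos[OF _ _ q])
    show "block i j X \<in> carrier_mat (j - i + 1) (j - i + 1)" unfolding block_eq[OF X'(1) ij] by simp
    show "upper_triangular (block i j X)"
      unfolding block_eq[OF X'(1) ij] using X' ij by (intro upper_triangularI) (auto simp: upper_triangularD)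
    show "block i j X $$ (k, k) \<noteq> 0" if "k < j - i + 1" for k
      unfolding block_eq[OF X'(1) ij] using X'(3) ij that by auto
  qed
qed

text \<open>Each outer factor costs \<open>(m * r) ^ q\<close> for block size \<open>m\<close>.
  Since \<open>m\<close> and \<open>q\<close> are at most \<open>n\<close>, this is bounded by
  \<open>(n * r) ^ n\<close>, uniformly in the index.\<close>

lemma enorm_block_mult_le:
  assumes c: "c \<in> carrier (UT n)" and y: "y \<in> carrier (UT n)" and d: "d \<in> carrier (UT n)"
    and rc: "\<And>a b. a < n \<Longrightarrow> b < n \<Longrightarrow> \<bar>c $$ (a, b)\<bar> \<le> r"
    and rd: "\<And>a b. a < n \<Longrightarrow> b < n \<Longrightarrow> \<bar>d $$ (a, b)\<bar> \<le> r"
    and r: "1 \<le> r" and ij: "1 \<le> i" "i \<le> j" "j \<le> n" and q: "q \<le> j - i + 1"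
  shows "enorm q (block i j (c * y * d)) \<le> ((real n * r) ^ n) ^ 2 * enorm q (block i j y)"
proof -
  let ?m = "j - i + 1" and ?k = "(real n * r) ^ n"
  have U: "c \<in> carrier_mat n n" "upper_triangular c" "y \<in> carrier_mat n n" "upper_triangular y"
    "d \<in> carrier_mat n n" "upper_triangular d"
    using c y d by (auto simp: carrier_UT_diag)
  have B: "block i j X \<in> carrier_mat ?m ?m" if "X \<in> carrier_mat n n" for X
    unfolding block_eq[OF that ij] by simp
  have bd: "\<bar>block i j X $$ (a, b)\<bar> \<le> r"
    if "X \<in> carrier_mat n n" "\<And>a b. a < n \<Longrightarrow> b < n \<Longrightarrow> \<bar>X $$ (a, b)\<bar> \<le> r" "a < ?m" "b < ?m" for X a b
    unfolding block_eq[OF that(1) ij] using that ij by auto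
  have "(real ?m * r) ^ q \<le> (real n * r) ^ q"
    using ij r by (intro power_mono mult_right_mono) auto
  also have "\<dots> \<le> ?k"
  proof (rule power_increasing)
    \<comment> \<open>Raising the exponent from \<open>q\<close> to \<open>n\<close> needs a base of
      at least \<open>1\<close>; hence the hypothesis \<open>1 \<le> r\<close>.\<close>
    have "1 * 1 \<le> real n * r" using ij r by (intro mult_mono) auto
    then show "1 \<le> real n * r" by simp
  qed (use q ij in auto)
  finally have k: "(real ?m * r) ^ q \<le> ?k" .
  have e: "0 \<le> enorm q (block i j X)" if "X \<in> carrier (UT n)" for X
    using enorm_block_pos[OF that ij q] by simp
  have yd: "y * d \<in> carrier (UT n)"
    using group.is_monoid[OF group_UT, THEN monoid.m_closed, OF y d] by simp
  have "enorm q (block i j (c * y * d)) = enorm q (block i j c * block i j (y * d))"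
    using block_mult[OF U(1,2) _ _ ij, of "y * d"] U yd by (simp add: carrier_UT_diag)
  also have "\<dots> \<le> (real ?m * r) ^ q * enorm q (block i j (y * d))"
    using U rc by (intro enorm_mult_left_le[OF B B q] bd) auto
  also have "\<dots> \<le> ?k * enorm q (block i j (y * d))"
    using k e[OF yd] by (rule mult_right_mono)
  also have "enorm q (block i j (y * d)) = enorm q (block i j y * block i j d)"
    using block_mult[OF U(3-6) ij] by simp
  also have "\<dots> \<le> (real ?m * r) ^ q * enorm q (block i j y)"
    using U rd by (intro enorm_mult_right_le[OF B B q] bd) auto
  also have "\<dots> \<le> ?k * enorm q (block i j y)"
    using k e[OF y] by (rule mult_right_mono)
  finally show ?thesis using r by (simp add: power2_eq_square mult_left_mono mult.assoc)
qed

section \<open>Change of \<open>mu\<close> under two-sided multiplication\<close>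

lemma mu_apply:
  "(i, j, q, e) \<in> \<Lambda> \<Longrightarrow> mu n \<Lambda> X (i, j, q, e) = ln (enorm q (block i j (X [^]\<^bsub>UT n\<^esub> e)))"
  by (simp add: mu_def enorm_def)

text \<open>For exponent \<open>-1\<close> inversion reverses the product, so the outer factors
  become \<open>minv d\<close> and \<open>minv c\<close>. This is why the bound \<open>r\<close>
  covers the inverses as well.\<close>

lemma mu_le:
  assumes l: "l \<in> \<Lambda>" "\<Lambda> \<subseteq> Index1 n"
    and c: "c \<in> carrier (UT n)" and y: "y \<in> carrier (UT n)" and d: "d \<in> carrier (UT n)"
    and r: "1 \<le> r" "\<And>X a b. X \<in> {c, d, minv c, minv d} \<Longrightarrow> a < n \<Longrightarrow> b < n \<Longrightarrow> \<bar>X $$ (a, b)\<bar> \<le> r"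
  shows "mu n \<Lambda> (c * y * d) l \<le> ln (((real n * r) ^ n) ^ 2) + mu n \<Lambda> y l"
proof -
  interpret UT: group "UT n" by (rule group_UT)
  let ?K = "((real n * r) ^ n) ^ 2"
  obtain i j q e where l': "l = (i, j, q, e)" by (cases l)
  then have ij: "1 \<le> i" "i \<le> j" "j \<le> n" "q \<le> j - i + 1" and e: "e = 1 \<or> e = -1"
    using l by (auto simp: Index1_def)
  have cyd: "c * y * d \<in> carrier (UT n)"
    using UT.m_closed[OF UT.m_closed[OF c y] d] by simp
  have "enorm q (block i j ((c * y * d) [^]\<^bsub>UT n\<^esub> e)) \<le> ?K * enorm q (block i j (y [^]\<^bsub>UT n\<^esub> e))"
    using e
  proof
    assume e: "e = 1"
    show ?thesis
      unfolding e UT.int_pow_1[OF cyd] UT.int_pow_1[OF y]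
      using r by (intro enorm_block_mult_le c y d ij) auto
  next
    assume e: "e = - 1"
    have inv: "X [^]\<^bsub>UT n\<^esub> (- 1 :: int) = minv X" if "X \<in> carrier (UT n)" for X
      using UT.int_pow_neg[OF that, of 1] m_inv_UT[OF that] that by simp
    have "minv (c * y * d) = inv\<^bsub>UT n\<^esub> (c \<otimes>\<^bsub>UT n\<^esub> y \<otimes>\<^bsub>UT n\<^esub> d)"
      using m_inv_UT[OF cyd] by simp
    also have "\<dots> = inv\<^bsub>UT n\<^esub> d \<otimes>\<^bsub>UT n\<^esub> (inv\<^bsub>UT n\<^esub> y \<otimes>\<^bsub>UT n\<^esub> inv\<^bsub>UT n\<^esub> c)"
      using c y d by (simp add: UT.inv_mult_group del: UT_simps)
    also have "\<dots> = minv d * (minv y * minv c)"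
      using c y d by (simp add: m_inv_UT)
    also have "\<dots> = minv d * minv y * minv c"
      using c y d by (simp add: assoc_mult_mat[of _ n n _ n _ n] minv carrier_UT_det)
    finally have i: "minv (c * y * d) = minv d * minv y * minv c" .
    show ?thesis
      unfolding e inv[OF cyd] inv[OF y] i
      using r by (intro enorm_block_mult_le minv_carrier_UT c y d ij) auto
  qed
  moreover have pos: "0 < enorm q (block i j (X [^]\<^bsub>UT n\<^esub> e))" if "X \<in> carrier (UT n)" for X
    using UT.int_pow_closed[OF that] ij by (rule enorm_block_pos)
  ultimately have "ln (enorm q (block i j ((c * y * d) [^]\<^bsub>UT n\<^esub> e))) \<le>
      ln (?K * enorm q (block i j (y [^]\<^bsub>UT n\<^esub> e)))"
    using pos[OF cyd] by simp
  also have "\<dots> = ln ?K + ln (enorm q (block i j (y [^]\<^bsub>UT n\<^esub> e)))"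
  proof (rule ln_mult_pos)
    show "0 < ?K" using ij r(1) by simp
  qed (rule pos[OF y])
  finally show ?thesis using l(1) unfolding l' by (simp only: mu_apply)
qed

text \<open>Applies \<open>mu_le\<close> to \<open>c * y * minv d\<close> and, for the opposite
  estimate, to \<open>y\<close> written as \<open>minv c * ?x * d\<close>. The set bounded by
  \<open>r\<close> is closed under inversion, so one constant serves both times.\<close>

lemma mu_diff_le:
  assumes l: "l \<in> \<Lambda>" "\<Lambda> \<subseteq> Index1 n"
    and c: "c \<in> carrier (UT n)" and y: "y \<in> carrier (UT n)" and d: "d \<in> carrier (UT n)"
    and r: "1 \<le> r" "\<And>X a b. X \<in> {c, d, minv c, minv d} \<Longrightarrow> a < n \<Longrightarrow> b < n \<Longrightarrow> \<bar>X $$ (a, b)\<bar> \<le> r"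
  shows "\<bar>mu n \<Lambda> (c * y * minv d) l - mu n \<Lambda> y l\<bar> \<le> ln (((real n * r) ^ n) ^ 2)"
proof -
  interpret UT: group "UT n" by (rule group_UT)
  note ic = minv_carrier_UT[OF c] and id = minv_carrier_UT[OF d]
  have ii: "minv (minv X) = X" if "X \<in> carrier (UT n)" for X
    using UT.inv_inv[OF that] m_inv_UT[OF that] m_inv_UT[OF minv_carrier_UT[OF that]] by simp
  let ?x = "c * y * minv d"
  have x: "?x \<in> carrier (UT n)" using UT.m_closed[OF UT.m_closed[OF c y] id] by simp
  have "mu n \<Lambda> ?x l \<le> ln (((real n * r) ^ n) ^ 2) + mu n \<Lambda> y l"
    using r(2) by (intro mu_le[OF l c y id r(1)]) (auto simp: ii[OF d])
  moreover have "y = minv c * ?x * d"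
  proof -
    have "y = inv\<^bsub>UT n\<^esub> c \<otimes>\<^bsub>UT n\<^esub> (c \<otimes>\<^bsub>UT n\<^esub> y \<otimes>\<^bsub>UT n\<^esub> inv\<^bsub>UT n\<^esub> d) \<otimes>\<^bsub>UT n\<^esub> d"
      using c y d by (simp add: UT.m_assoc UT.m_assoc[symmetric, of "inv\<^bsub>UT n\<^esub> c" c] del: UT_simps)
    then show ?thesis using m_inv_UT[OF c] m_inv_UT[OF d] by simp
  qed
  then have "mu n \<Lambda> y l \<le> ln (((real n * r) ^ n) ^ 2) + mu n \<Lambda> ?x l"
    using mu_le[OF l ic x d r(1)] r(2) ii[OF c] by auto
  ultimately show ?thesis by linarith
qed

lemma max_dist_le_iff:
  assumes "finite \<Lambda>" "\<Lambda> \<noteq> {}"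
  shows "max_dist \<Lambda> x y \<le> M \<longleftrightarrow> (\<forall>l\<in>\<Lambda>. \<bar>x l - y l\<bar> \<le> M)"
  using assms by (simp add: max_dist_def)

lemma finite_Index1: "finite (Index1 n)"
proof (rule finite_subset)
  show "Index1 n \<subseteq> {1..n} \<times> {1..n} \<times> {1..n} \<times> {1, -1}" by (auto simp: Index1_def)
qed simp

text \<open>The compact set of an entourage of \<open>G\<close>, enlarged by its inverses, has
  uniformly bounded entries; the resulting constant is the same for all pairs and all
  indices.\<close>

lemma mu_controlled:
  assumes n: "1 \<le> n" and \<Lambda>: "Index0 n \<subseteq> \<Lambda>" "\<Lambda> \<subseteq> Index1 n"
    and G: "closed_subgroup G (UT n) (UT_top n)"
  shows "controlled_map (LR_coarse (UT n\<lparr>carrier := G\<rparr>) (subtopology (UT_top n) G))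
    (bounded_coarse (RR \<Lambda>) (max_dist \<Lambda>)) (mu n \<Lambda>)"
  unfolding controlled_map_def
proof
  interpret UT: lch_group "UT n" "UT_top n" by (rule lch_group_UT)
  have sG: "subgroup G (UT n)" using G by (simp add: closed_subgroup_def)
  then have GU: "G \<subseteq> carrier (UT n)" by (rule subgroup.subset)
  have fin: "finite \<Lambda>" using \<Lambda>(2) finite_Index1 finite_subset by blast
  have ne: "\<Lambda> \<noteq> {}" using n \<Lambda>(1) by (auto simp: Index0_def)
  fix E assume "E \<in> LR_coarse (UT n\<lparr>carrier := G\<rparr>) (subtopology (UT_top n) G)"
  then obtain C where E: "E \<subseteq> G \<times> G" and C: "compactin (UT_top n) C" "C \<subseteq> G"
    and EC: "\<forall>(x, y)\<in>E. \<exists>c\<in>C. \<exists>d\<in>C. x = c * y * inv\<^bsub>UT n\<lparr>carrier := G\<rparr>\<^esub> d"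
    unfolding LR_coarse_iff by (auto simp: compactin_subtopology)
  have CU: "C \<subseteq> carrier (UT n)" using C(2) GU by blast
  \<comment> \<open>Rewritten with the group inverse, the image is compact by continuity of
    inversion.\<close>
  have iC: "minv ` C = (\<lambda>x. inv\<^bsub>UT n\<^esub> x) ` C"
    using CU m_inv_UT by (intro image_cong) auto
  have "compactin (UT_top n) (C \<union> minv ` C)"
    unfolding iC using C(1) image_compactin[OF C(1) UT.continuous_inv] by (rule compactin_Un)
  then obtain r where r: "\<And>X i j. X \<in> C \<union> minv ` C \<Longrightarrow> i < n \<Longrightarrow> j < n \<Longrightarrow> \<bar>X $$ (i, j)\<bar> \<le> r"
    using compactin_UT_bounded by metis
  \<comment> \<open>The maximum with \<open>1\<close> secures the lower bound on \<open>r\<close> in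
    \<open>mu_diff_le\<close>.\<close>
  let ?K = "ln (((real n * max 1 r) ^ n) ^ 2)"
  have "max_dist \<Lambda> (mu n \<Lambda> x) (mu n \<Lambda> y) \<le> ?K" if xy: "(x, y) \<in> E" for x y
    unfolding max_dist_le_iff[OF fin ne]
  proof
    fix l assume l: "l \<in> \<Lambda>"
    obtain c d where cd: "c \<in> C" "d \<in> C" "x = c * y * inv\<^bsub>UT n\<lparr>carrier := G\<rparr>\<^esub> d"
      using EC xy by blast
    then have cdU: "c \<in> carrier (UT n)" "d \<in> carrier (UT n)" using CU by auto
    have "d \<in> G" using cd C(2) by blast
    then have x: "x = c * y * minv d"
      using cd(3) UT.m_inv_consistent[OF sG] m_inv_UT[OF cdU(2)] by simp
    have y: "y \<in> carrier (UT n)" using xy E GU by blast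
    show "\<bar>mu n \<Lambda> x l - mu n \<Lambda> y l\<bar> \<le> ?K"
      unfolding x
    proof (rule mu_diff_le[OF l \<Lambda>(2) cdU(1) y cdU(2)])
      fix X a b assume "X \<in> {c, d, minv c, minv d}" "a < n" "b < n"
      then have "\<bar>X $$ (a, b)\<bar> \<le> r" using cd by (intro r) auto
      then show "\<bar>X $$ (a, b)\<bar> \<le> max 1 r" by simp
    qed simp
  qed
  then show "{(mu n \<Lambda> x, mu n \<Lambda> y) | x y. (x, y) \<in> E} \<in> bounded_coarse (RR \<Lambda>) (max_dist \<Lambda>)"
    unfolding bounded_coarse_def by (auto simp: mu_def)
qed

section \<open>Coarse properness and the conclusion\<close>

lemma mu_diagonal:
  assumes "(i, i, 1, 1) \<in> \<Lambda>" "1 \<le> i" "i \<le> n" "X \<in> carrier (UT n)"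
  shows "mu n \<Lambda> X (i, i, 1, 1) = ln \<bar>X $$ (i - 1, i - 1)\<bar>"
proof -
  interpret UT: group "UT n" by (rule group_UT)
  have X: "X \<in> carrier_mat n n" using assms by (simp add: carrier_UT_diag)
  have "enorm 1 (block i i X) = \<bar>X $$ (i - 1, i - 1)\<bar>"
    using block_eq[OF X, of i i] assms enorm_1_dim_1[of "block i i X"] by simp
  then show ?thesis using assms by (simp add: mu_apply)
qed

text \<open>The block from \<open>1\<close> to \<open>n\<close> is the whole matrix, and for
  \<open>q = 1\<close> its minors are the entries.\<close>

lemma abs_entry_le_exp_mu:
  assumes "(1, n, 1, 1) \<in> \<Lambda>" "1 \<le> n" "X \<in> carrier (UT n)" "i < n" "j < n"
  shows "\<bar>X $$ (i, j)\<bar> \<le> exp (mu n \<Lambda> X (1, n, 1, 1))"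
proof -
  interpret UT: group "UT n" by (rule group_UT)
  have X: "X \<in> carrier_mat n n" using assms by (simp add: carrier_UT_diag)
  have "block 1 n X = mat n n (\<lambda>(a, b). X $$ (a, b))"
    using block_eq[OF X, of 1 n] assms by simp
  also have "\<dots> = X" using X by (intro eq_matI) auto
  finally have b: "block 1 n X = X" .
  have "0 < enorm 1 X" using enorm_block_pos[of X n 1 n 1] assms b by simp
  then show ?thesis using abs_entry_le_enorm_1[OF X assms(4,5)] assms b by (simp add: mu_apply)
qed

text \<open>If all coordinates are at most \<open>M\<close> in absolute value, the one for
  \<open>(1, n, 1, 1)\<close> bounds every entry by \<open>exp M\<close>, and the diagonal ones keep
  the diagonal entries at least \<open>exp (- M)\<close> in size. This is a compact box, which
  closedness of \<open>G\<close> cuts down to a compact subset of \<open>G\<close>.\<close>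

lemma mu_coarsely_proper:
  assumes n: "1 \<le> n" and \<Lambda>: "Index0 n \<subseteq> \<Lambda>" "\<Lambda> \<subseteq> Index1 n"
    and G: "closed_subgroup G (UT n) (UT_top n)"
  shows "coarsely_proper_map G (LR_coarse (UT n\<lparr>carrier := G\<rparr>) (subtopology (UT_top n) G))
    (RR \<Lambda>) (bounded_coarse (RR \<Lambda>) (max_dist \<Lambda>)) (mu n \<Lambda>)"
  unfolding coarsely_proper_map_def
proof (intro allI impI)
  interpret UT: lch_group "UT n" "UT_top n" by (rule lch_group_UT)
  interpret G: lch_group "UT n\<lparr>carrier := G\<rparr>" "subtopology (UT_top n) G"
    by (rule UT.lch_group_subgroup[OF G])
  have cG: "closedin (UT_top n) G" and GU: "G \<subseteq> carrier (UT n)"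
    using G subgroup.subset by (auto simp: closed_subgroup_def)
  have fin: "finite \<Lambda>" using \<Lambda>(2) finite_Index1 finite_subset by blast
  have ne: "\<Lambda> \<noteq> {}" using n \<Lambda>(1) by (auto simp: Index0_def)
  fix B assume B: "coarsely_bounded (bounded_coarse (RR \<Lambda>) (max_dist \<Lambda>)) B"
  let ?P = "{X \<in> G. mu n \<Lambda> X \<in> B}"
  have "\<exists>M. \<forall>x\<in>B. \<forall>l\<in>\<Lambda>. \<bar>x l\<bar> \<le> M"
  proof (cases "B = {}")
    case False
    then obtain b where b: "b \<in> B" by blast
    obtain M where M: "\<forall>(x, y)\<in>B \<times> B. max_dist \<Lambda> x y \<le> M"
      using B by (auto simp: coarsely_bounded_def bounded_coarse_def)
    \<comment> \<open>The metric bounds differences only; the base point \<open>b\<close> turns this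
      into a bound on the coordinates themselves.\<close>
    have "\<bar>x l\<bar> \<le> M + (\<Sum>l\<in>\<Lambda>. \<bar>b l\<bar>)" if "x \<in> B" "l \<in> \<Lambda>" for x l
    proof -
      have "max_dist \<Lambda> x b \<le> M" using M that b by blast
      then have "\<bar>x l - b l\<bar> \<le> M" using that unfolding max_dist_le_iff[OF fin ne] by blast
      moreover have "\<bar>b l\<bar> \<le> (\<Sum>l\<in>\<Lambda>. \<bar>b l\<bar>)"
        using member_le_sum[of l \<Lambda> "\<lambda>l. \<bar>b l\<bar>"] that fin by simp
      ultimately show ?thesis by linarith
    qed
    then show ?thesis by blast
  qed simp
  then obtain M where M: "\<And>x l. x \<in> B \<Longrightarrow> l \<in> \<Lambda> \<Longrightarrow> \<bar>x l\<bar> \<le> M" by blast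
  let ?K = "{X \<in> carrier (UT n). \<forall>i<n. (\<forall>j<n. \<bar>X $$ (i, j)\<bar> \<le> exp M) \<and> 1 / exp M \<le> \<bar>X $$ (i, i)\<bar>}"
  have "?P \<subseteq> ?K"
  proof
    fix X assume "X \<in> ?P"
    then have X: "X \<in> carrier (UT n)" "mu n \<Lambda> X \<in> B" using GU by auto
    have "\<bar>X $$ (i, j)\<bar> \<le> exp M" if "i < n" "j < n" for i j
    proof -
      have l: "(1, n, 1, 1) \<in> \<Lambda>" using \<Lambda>(1) n by (auto simp: Index0_def)
      have "\<bar>X $$ (i, j)\<bar> \<le> exp (mu n \<Lambda> X (1, n, 1, 1))"
        by (rule abs_entry_le_exp_mu[OF l n X(1) that])
      also have "\<dots> \<le> exp M" using M[OF X(2) l] by simp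
      finally show ?thesis .
    qed
    moreover have "1 / exp M \<le> \<bar>X $$ (i, i)\<bar>" if "i < n" for i
    proof -
      \<comment> \<open>The indices in \<Lambda> start at 1, matrix positions at 0.\<close>
      have l: "(Suc i, Suc i, 1, 1) \<in> \<Lambda>" using \<Lambda>(1) n that by (auto simp: Index0_def)
      have nz: "0 < \<bar>X $$ (i, i)\<bar>" using X(1) that by (simp add: carrier_UT_diag)
      have "- M \<le> ln \<bar>X $$ (i, i)\<bar>"
        using M[OF X(2) l] mu_diagonal[OF l _ _ X(1)] that by simp
      then have "exp (- M) \<le> exp (ln \<bar>X $$ (i, i)\<bar>)" by simp
      then show ?thesis using nz by (simp add: exp_minus inverse_eq_divide)
    qed
    ultimately show "X \<in> ?K" using X(1) by blast
  qed
  then have PK: "?P \<subseteq> ?K \<inter> G" by blast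
  have "compactin (UT_top n) (?K \<inter> G)"
    using compactin_UT_box[of "exp M" n] cG by (intro compact_Int_closedin) auto
  then have "compactin (subtopology (UT_top n) G) (?K \<inter> G)" by (simp add: compactin_subtopology)
  then show "coarsely_bounded (LR_coarse (UT n\<lparr>carrier := G\<rparr>) (subtopology (UT_top n) G)) ?P"
    using PK by (subst G.coarsely_bounded_LR_coarse_iff) auto
qed

theorem theorem6p1:
  fixes n :: nat and \<Lambda> :: "index set" and G :: "real mat set"
  assumes "n \<ge> 1"
    and "Index0 n \<subseteq> \<Lambda>" and "\<Lambda> \<subseteq> Index1 n"
    and "closed_subgroup G (UT n) (UT_top n)"
  shows "coarse_map G (LR_coarse (UT n\<lparr>carrier := G\<rparr>) (subtopology (UT_top n) G))
           (RR \<Lambda>) (bounded_coarse (RR \<Lambda>) (max_dist \<Lambda>)) (mu n \<Lambda>) \<and>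
    (\<forall>L H. closed_subgroup L (UT n\<lparr>carrier := G\<rparr>) (subtopology (UT_top n) G) \<longrightarrow>
           closed_subgroup H (UT n\<lparr>carrier := G\<rparr>) (subtopology (UT_top n) G) \<longrightarrow>
           asymptotically_disjoint (RR \<Lambda>) (bounded_coarse (RR \<Lambda>) (max_dist \<Lambda>))
             (mu n \<Lambda> ` L) (mu n \<Lambda> ` H) \<longrightarrow>
           proper_action (UT n\<lparr>carrier := L\<rparr>) (subtopology (UT_top n) L)
             (coset_topology (UT n\<lparr>carrier := G\<rparr>) (subtopology (UT_top n) G) H)
             (coset_action (UT n\<lparr>carrier := G\<rparr>) H))"
proof (intro conjI allI impI)
  interpret UT: lch_group "UT n" "UT_top n" by (rule lch_group_UT)
  interpret G: lch_group "UT n\<lparr>carrier := G\<rparr>" "subtopology (UT_top n) G"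
    by (rule UT.lch_group_subgroup[OF assms(4)])
  have "mu n \<Lambda> \<in> G \<rightarrow> RR \<Lambda>" by (auto simp: mu_def)
  then show coarse: "coarse_map G (LR_coarse (UT n\<lparr>carrier := G\<rparr>) (subtopology (UT_top n) G))
      (RR \<Lambda>) (bounded_coarse (RR \<Lambda>) (max_dist \<Lambda>)) (mu n \<Lambda>)"
    unfolding coarse_map_def using mu_controlled[OF assms] mu_coarsely_proper[OF assms] by simp
  fix L H
  assume L: "closed_subgroup L (UT n\<lparr>carrier := G\<rparr>) (subtopology (UT_top n) G)"
    and H: "closed_subgroup H (UT n\<lparr>carrier := G\<rparr>) (subtopology (UT_top n) G)"
    and disj: "asymptotically_disjoint (RR \<Lambda>) (bounded_coarse (RR \<Lambda>) (max_dist \<Lambda>))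
      (mu n \<Lambda> ` L) (mu n \<Lambda> ` H)"
  have "L \<subseteq> G" using L subgroup.subset by (force simp: closed_subgroup_def)
  \<comment> \<open>\<open>L\<close> inherits the same topology from \<open>G\<close> as from the
    full group, which matches the general result inside \<open>G\<close> with the topology on
    \<open>L\<close> in the goal.\<close>
  then have "subtopology (subtopology (UT_top n) G) L = subtopology (UT_top n) L"
    by (simp add: subtopology_subtopology Int_absorb1)
  then show "proper_action (UT n\<lparr>carrier := L\<rparr>) (subtopology (UT_top n) L)
      (coset_topology (UT n\<lparr>carrier := G\<rparr>) (subtopology (UT_top n) G) H)
      (coset_action (UT n\<lparr>carrier := G\<rparr>) H)"
    using G.proper_action_if_asymptotically_disjoint[OF L H _ disj] coarse by simp
qed

end
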